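(* Let $\tau>1$ and $L\ge 1$ be integers, and let $\mathbb{V}$ be a value domain with $|\mathbb{V}|=2^D>1$. The storage cost (number $n$ of objects, each holding one block) of any regular, wait-free, $\tau$-disintegrated storage emulation of a multi-reader single-writer register over $\mathbb{V}$ with $R$ readers (whose $\mathtt{read}$s may be visible), in which every process stores at most $L$ blocks in its local data, is at least $$\tau+(\tau-1)\cdot\min\left(\left\lceil \frac{2^D-1}{L}\right\rceil,\,R\right)$$ blocks.
   Context: **Model.** An asynchronous shared memory system consists of a finite set $O=\{o_1,\dots,o_n\}$ of objects (the shared storage) and a set $\Pi$ of processes. Each entity $e\in O\cup\Pi$ stores data $e.\mathit{data}$ and potentially infinite meta-data $e.\mathit{meta}$. An object's data is a single block from some domain $\mathbb{B}$; a process' data is an array of up to $L$ blocks from $\mathbb{B}$. The storage cost is $n$, the number of objects. Objects support atomic, instantaneous actions by processes: $o.\mathtt{update}_p$ is an arbitrary read-modify-write that possibly writes a block to $o.\mathit{data}$ and modifies $o.\mathit{meta}$, $p.\mathit{meta}$ and $p.\mathit{data}$; $o.\mathtt{get}_p$ may replace a block in $p.\mathit{data}$ with $o.\mathit{data}$ and may modify $p.\mathit{meta}$. An algorithm defines processes as deterministic state machines whose transitions are associated with actions; an action associated with a transition from the current state is called enabled. A configuration assigns states (data and meta) to all processes and objects. A run is a finite or infinite alternating sequence of configurations and actions (events), starting at an initial configuration and following the algorithm; events are invocations and responses (returns) of high-level operations and $\mathtt{get}$/$\mathtt{update}$ occurrences. Time $t$ in a run $r$ is the configuration after the $t$-th event.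 Each process' first action is an invocation and it has at most one pending (invoked, not returned) operation at any time. Two operations are concurrent if both are invoked before either returns. $e.\mathit{data}(r,t)$ is the set of distinct blocks in $e.\mathit{data}$ at time $t$ in $r$ (for an object, identified with its single block). Process $p$ obtains block $b$ at time $t$ in $r$ if $b\notin p.\mathit{data}(r,t)$ and $b\in p.\mathit{data}(r,t+1)$. **Register emulation.** The algorithm emulates a register over a domain $\mathbb{V}$, $|\mathbb{V}|=2^D>1$, with high-level operations $\mathtt{read}_p$ and $\mathtt{write}(v)$, $v\in\mathbb{V}$. Each run begins with a dummy initialization operation writing the initial value and overlapping no operation. Single-writer: only one process, the writer, invokes $\mathtt{write}$s; the other $R=|\Pi|-1$ processes (readers) invoke only $\mathtt{read}$s. Multi-reader means $R>1$. Whenever a $\mathtt{read}_p$ is invoked at time $t$ in $r$, $p.\mathit{data}(r,t)$ is empty. Readers never write data blocks to objects. Reads are visible if $\mathtt{read}$s may perform $\mathtt{update}$s that update meta-data (only) in the shared storage. Regularity: a $\mathtt{read}$ returns the value of either the last $\mathtt{write}$ that returns before the $\mathtt{read}$ is invoked or some $\mathtt{write}$ concurrent with it. Wait-freedom: every operation invoked by a process $p$ returns within a finite number of $p$'s actions (regardless of other processes). **Labels (analysis tool only, not part of the state available to the algorithm).** $\mathbb{W}_v$ is the set of $\mathtt{write}(v)$ operations invoked in runs of the algorithm. Each block $b$ in shared or local storage carries a label set $\mathit{Labels}(b)$. The $k$-th $\mathtt{update}$ event of a $\mathtt{write}$ operation $w$ tags the block it stores (if any) with the unique label $\langle w,k\rangle$,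 so that block's label set becomes $\{\langle w,k\rangle\}$ (each block in the shared storage pertains to a single write). When a reader $p$ obtains a block $b$ from an object $o$ at time $t$ in $r$, the block $b$ in $p.\mathit{data}(r,t+1)$ is tagged with $\mathit{Labels}(o.\mathit{data}(r,t))$; if at a later time $t'$ $p.\mathit{data}$ still contains $b$ and $p$ performs an action on an object $o'$ with $o'.\mathit{data}(r,t')=b$ tagged with label $\ell$, then $\ell$ is added to $\mathit{Labels}(b)$ at $p$. When all copies of $b$ are removed from $p.\mathit{data}$, its labels there are forgotten. For $v\in\mathbb{V}$, $\mathit{L\text{-}labels}_p(v,r,t)=\big(\bigcup_{b\in p.\mathit{data}(r,t)}\mathit{Labels}(b)\big)\cap(\mathbb{W}_v\times\mathbb{N})$. **$\tau$-disintegrated storage.** The algorithm is $\tau$-disintegrated storage if whenever a return of $v\in\mathbb{V}$ by a $\mathtt{read}_p$ invocation is enabled at time $t$ in a run $r$, $|\mathit{L\text{-}labels}_p(v,r,t)|\ge\tau$.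
   Formalization: "Each block pertains to a single write" is made an explicit hypothesis, in the form that all labels a reader collects on one held block belong to writes of a single value; without it the bound fails (one-block domain, τ=2, L=1, D=2, R=2, n=3). *)

theory Defs
  imports Complex_Main "HOL-Library.Cardinality"
begin

section \<open>Algorithms over a shared storage of objects\<close>

text \<open>
  Type variables: \<open>'p\<close> processes, \<open>'o\<close> objects, \<open>'v\<close> register values, \<open>'b\<close> data blocks,
  \<open>'pm\<close> and \<open>'om\<close> meta-data of processes and objects (arbitrary, possibly infinite types).
  The local data array is a map from slots to blocks; a slot mapped to \<open>None\<close> is empty.
\<close>

record ('b, 'pm) proc_state =
  pdata :: "nat \<Rightarrow> 'b option"
  pmeta :: 'pm

record ('b, 'om) obj_state =
  odata :: 'b
  ometa :: 'om

datatype 'v operation = Read | Write 'v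

text \<open>
  The result of a returning operation is \<open>Some v\<close> for a value \<open>v\<close>, and \<open>None\<close> for an
  acknowledgement that carries no value.
\<close>

datatype ('o, 'v) action = DoGet 'o | DoUpdate 'o | DoReturn "'v option"

datatype ('p, 'o, 'v) event =
    Invoke 'p "'v operation"
  | Return 'p "'v option"
  | Get 'p 'o
  | Update 'p 'o

fun actor :: "('p, 'o, 'v) event \<Rightarrow> 'p" where
  "actor (Invoke p x) = p"
| "actor (Return p y) = p"
| "actor (Get p x) = p"
| "actor (Update p x) = p"

text \<open>
  Processes are deterministic state machines: while an operation is pending, \<open>next_action\<close> is the
  action associated with the transition from the current local state.
  \<open>on_get\<close> yields the new meta-data and possibly a slot that receives the object's block, and
  \<open>on_update\<close> yields the new local state, the new object meta-data and possibly a block to be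
  stored in the object.
\<close>

record ('p, 'o, 'v, 'b, 'pm, 'om) algorithm =
  writer :: 'p
  init_value :: 'v
  init_proc :: "'p \<Rightarrow> ('b, 'pm) proc_state"
  init_obj :: "'o \<Rightarrow> ('b, 'om) obj_state"
  next_action :: "'p \<Rightarrow> ('b, 'pm) proc_state \<Rightarrow> ('o, 'v) action"
  on_invoke :: "'p \<Rightarrow> 'v operation \<Rightarrow> ('b, 'pm) proc_state \<Rightarrow> ('b, 'pm) proc_state"
  on_return :: "'p \<Rightarrow> ('b, 'pm) proc_state \<Rightarrow> ('b, 'pm) proc_state"
  on_get :: "'p \<Rightarrow> ('b, 'pm) proc_state \<Rightarrow> ('b, 'om) obj_state \<Rightarrow> 'pm \<times> nat option"
  on_update :: "'p \<Rightarrow> ('b, 'pm) proc_state \<Rightarrow> ('b, 'om) obj_state \<Rightarrow>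
    ('b, 'pm) proc_state \<times> 'om \<times> 'b option"

record ('p, 'o, 'b, 'pm, 'om) configuration =
  procs :: "'p \<Rightarrow> ('b, 'pm) proc_state"
  objs :: "'o \<Rightarrow> ('b, 'om) obj_state"

definition after_get ::
  "('b, 'pm) proc_state \<Rightarrow> 'b \<Rightarrow> 'pm \<times> nat option \<Rightarrow> ('b, 'pm) proc_state" where
  "after_get s b res = (case res of
     (m, None) \<Rightarrow> s\<lparr>pmeta := m\<rparr>
   | (m, Some i) \<Rightarrow> s\<lparr>pmeta := m, pdata := (pdata s)(i := Some b)\<rparr>)"

definition after_update ::
  "('b, 'om) obj_state \<Rightarrow> 'om \<Rightarrow> 'b option \<Rightarrow> ('b, 'om) obj_state" where
  "after_update q m res = (case res of
     None \<Rightarrow> q\<lparr>ometa := m\<rparr>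
   | Some b \<Rightarrow> q\<lparr>ometa := m, odata := b\<rparr>)"

fun step ::
  "('p, 'o, 'v, 'b, 'pm, 'om) algorithm \<Rightarrow> ('p, 'o, 'v) event \<Rightarrow>
   ('p, 'o, 'b, 'pm, 'om) configuration \<Rightarrow> ('p, 'o, 'b, 'pm, 'om) configuration" where
  "step A (Invoke p x) c = c\<lparr>procs := (procs c)(p := on_invoke A p x (procs c p))\<rparr>"
| "step A (Return p y) c = c\<lparr>procs := (procs c)(p := on_return A p (procs c p))\<rparr>"
| "step A (Get p x) c =
     c\<lparr>procs := (procs c)(p :=
       after_get (procs c p) (odata (objs c x)) (on_get A p (procs c p) (objs c x)))\<rparr>"
| "step A (Update p x) c = (case on_update A p (procs c p) (objs c x) of
     (s, m, res) \<Rightarrow>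
       c\<lparr>procs := (procs c)(p := s), objs := (objs c)(x := after_update (objs c x) m res)\<rparr>)"


section \<open>Runs\<close>

text \<open>
  Transitions are deterministic, so a finite run is represented by its list \<open>r\<close> of events. Time
  \<open>t \<le> length r\<close> is the configuration after the first \<open>t\<close> events; event \<open>r ! t\<close> leads from
  time \<open>t\<close> to time \<open>t + 1\<close>. An operation is identified by the position of its invocation in \<open>r\<close>.
\<close>

primrec config ::
  "('p, 'o, 'v, 'b, 'pm, 'om) algorithm \<Rightarrow> ('p, 'o, 'v) event list \<Rightarrow> nat \<Rightarrow>
   ('p, 'o, 'b, 'pm, 'om) configuration" where
  "config A r 0 = \<lparr>procs = init_proc A, objs = init_obj A\<rparr>"
| "config A r (Suc t) = step A (r ! t) (config A r t)"

definition pstate_at ::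
  "('p, 'o, 'v, 'b, 'pm, 'om) algorithm \<Rightarrow> ('p, 'o, 'v) event list \<Rightarrow> nat \<Rightarrow> 'p \<Rightarrow>
   ('b, 'pm) proc_state" where
  "pstate_at A r t p = procs (config A r t) p"

definition ostate_at ::
  "('p, 'o, 'v, 'b, 'pm, 'om) algorithm \<Rightarrow> ('p, 'o, 'v) event list \<Rightarrow> nat \<Rightarrow> 'o \<Rightarrow>
   ('b, 'om) obj_state" where
  "ostate_at A r t x = objs (config A r t) x"

definition local_blocks ::
  "('p, 'o, 'v, 'b, 'pm, 'om) algorithm \<Rightarrow> ('p, 'o, 'v) event list \<Rightarrow> nat \<Rightarrow> 'p \<Rightarrow> 'b set" where
  "local_blocks A r t p = ran (pdata (pstate_at A r t p))"

definition shared_block ::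
  "('p, 'o, 'v, 'b, 'pm, 'om) algorithm \<Rightarrow> ('p, 'o, 'v) event list \<Rightarrow> nat \<Rightarrow> 'o \<Rightarrow> 'b" where
  "shared_block A r t x = odata (ostate_at A r t x)"

definition written_block ::
  "('p, 'o, 'v, 'b, 'pm, 'om) algorithm \<Rightarrow> ('p, 'o, 'v) event list \<Rightarrow> nat \<Rightarrow> 'p \<Rightarrow> 'o \<Rightarrow>
   'b option" where
  "written_block A r t p x = snd (snd (on_update A p (pstate_at A r t p) (ostate_at A r t x)))"

definition pending :: "('p, 'o, 'v) event list \<Rightarrow> nat \<Rightarrow> 'p \<Rightarrow> bool" where
  "pending r t p \<longleftrightarrow>
     (\<exists>i<t. (\<exists>x. r ! i = Invoke p x) \<and> (\<forall>j. i < j \<and> j < t \<longrightarrow> (\<forall>y. r ! j \<noteq> Return p y)))"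

definition is_reader :: "('p, 'o, 'v, 'b, 'pm, 'om) algorithm \<Rightarrow> 'p \<Rightarrow> bool" where
  "is_reader A p \<longleftrightarrow> p \<noteq> writer A"

text \<open>
  An idle process may be asked to perform any operation of its role. The first event of a run is
  the invocation of the initializing write; as this write overlaps no other operation, nothing
  else is invoked until the writer has returned for the first time.
\<close>

fun enabled ::
  "('p, 'o, 'v, 'b, 'pm, 'om) algorithm \<Rightarrow> ('p, 'o, 'v) event list \<Rightarrow> nat \<Rightarrow>
   ('p, 'o, 'v) event \<Rightarrow> bool" where
  "enabled A r t (Invoke p x) \<longleftrightarrow>
     \<not> pending r t p \<and>
     (if is_reader A p then x = Read else (\<exists>v. x = Write v)) \<and>
     (if t = 0 then p = writer A \<and> x = Write (init_value A)
      else (\<exists>j<t. \<exists>y. r ! j = Return (writer A) y))"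
| "enabled A r t (Return p y) \<longleftrightarrow>
     pending r t p \<and> next_action A p (pstate_at A r t p) = DoReturn y"
| "enabled A r t (Get p x) \<longleftrightarrow>
     pending r t p \<and> next_action A p (pstate_at A r t p) = DoGet x"
| "enabled A r t (Update p x) \<longleftrightarrow>
     pending r t p \<and> next_action A p (pstate_at A r t p) = DoUpdate x"

definition run ::
  "('p, 'o, 'v, 'b, 'pm, 'om) algorithm \<Rightarrow> ('p, 'o, 'v) event list \<Rightarrow> bool" where
  "run A r \<longleftrightarrow> (\<forall>t<length r. enabled A r t (r ! t))"

definition infinite_run ::
  "('p, 'o, 'v, 'b, 'pm, 'om) algorithm \<Rightarrow> (nat \<Rightarrow> ('p, 'o, 'v) event) \<Rightarrow> bool" where
  "infinite_run A f \<longleftrightarrow> (\<forall>t. run A (map f [0..<t]))"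


section \<open>Register emulations\<close>

definition register_emulation :: "('p, 'o, 'v, 'b, 'pm, 'om) algorithm \<Rightarrow> bool" where
  "register_emulation A \<longleftrightarrow>
     (\<forall>r t p. run A r \<and> t < length r \<and> r ! t = Invoke p Read \<longrightarrow> local_blocks A r t p = {}) \<and>
     (\<forall>r t p x. run A r \<and> t < length r \<and> r ! t = Update p x \<and> is_reader A p \<longrightarrow>
        written_block A r t p x = None)"

definition local_data_bounded :: "nat \<Rightarrow> ('p, 'o, 'v, 'b, 'pm, 'om) algorithm \<Rightarrow> bool" where
  "local_data_bounded L A \<longleftrightarrow>
     (\<forall>r t p. run A r \<and> t \<le> length r \<longrightarrow> dom (pdata (pstate_at A r t p)) \<subseteq> {..<L})"

definition returns_at :: "('p, 'o, 'v) event list \<Rightarrow> nat \<Rightarrow> nat \<Rightarrow> bool" where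
  "returns_at r i j \<longleftrightarrow> i < j \<and> j < length r \<and>
     (\<exists>p. (\<exists>x. r ! i = Invoke p x) \<and> (\<exists>y. r ! j = Return p y) \<and>
          (\<forall>k. i < k \<and> k < j \<longrightarrow> (\<forall>y. r ! k \<noteq> Return p y)))"

definition concurrent :: "('p, 'o, 'v) event list \<Rightarrow> nat \<Rightarrow> nat \<Rightarrow> bool" where
  "concurrent r i i' \<longleftrightarrow>
     (\<forall>j. returns_at r i j \<longrightarrow> i' < j) \<and> (\<forall>j. returns_at r i' j \<longrightarrow> i < j)"

definition is_write :: "('p, 'o, 'v) event list \<Rightarrow> nat \<Rightarrow> 'v \<Rightarrow> bool" where
  "is_write r w v \<longleftrightarrow> w < length r \<and> (\<exists>p. r ! w = Invoke p (Write v))"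

definition last_write_before :: "('p, 'o, 'v) event list \<Rightarrow> nat \<Rightarrow> nat \<Rightarrow> bool" where
  "last_write_before r w i \<longleftrightarrow>
     (\<exists>j<i. returns_at r w j \<and>
        (\<forall>w' v' j'. is_write r w' v' \<and> returns_at r w' j' \<and> j' < i \<longrightarrow> j' \<le> j))"

definition regular :: "('p, 'o, 'v, 'b, 'pm, 'om) algorithm \<Rightarrow> bool" where
  "regular A \<longleftrightarrow>
     (\<forall>r i j p y. run A r \<and> r ! i = Invoke p Read \<and> returns_at r i j \<and> r ! j = Return p y \<longrightarrow>
        (\<exists>v w. y = Some v \<and> is_write r w v \<and> (last_write_before r w i \<or> concurrent r w i)))"

text \<open>
  A process with a pending operation always has an enabled action, so an operation fails to return
  within finitely many actions of its process only along an infinite run in which this process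
  acts infinitely often.
\<close>

definition wait_free :: "('p, 'o, 'v, 'b, 'pm, 'om) algorithm \<Rightarrow> bool" where
  "wait_free A \<longleftrightarrow>
     (\<forall>f i p x. infinite_run A f \<and> f i = Invoke p x \<and> infinite {j. actor (f j) = p} \<longrightarrow>
        (\<exists>j>i. \<exists>y. f j = Return p y))"


section \<open>Labels\<close>

text \<open>
  The label \<open>(w, k)\<close> belongs to the \<open>k\<close>-th update event of the operation invoked at position \<open>w\<close>.
  Initial blocks, which no operation has stored, carry no label.
\<close>

type_synonym label = "nat \<times> nat"

definition current_op :: "('p, 'o, 'v) event list \<Rightarrow> nat \<Rightarrow> 'p \<Rightarrow> nat" where
  "current_op r t p = (GREATEST i. i < t \<and> (\<exists>x. r ! i = Invoke p x))"

definition update_label :: "('p, 'o, 'v) event list \<Rightarrow> nat \<Rightarrow> 'p \<Rightarrow> label" where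
  "update_label r t p =
     (current_op r t p, card {j. current_op r t p < j \<and> j \<le> t \<and> (\<exists>x. r ! j = Update p x)})"

primrec shared_labels ::
  "('p, 'o, 'v, 'b, 'pm, 'om) algorithm \<Rightarrow> ('p, 'o, 'v) event list \<Rightarrow> nat \<Rightarrow> 'o \<Rightarrow> label set" where
  "shared_labels A r 0 = (\<lambda>x. {})"
| "shared_labels A r (Suc t) = (\<lambda>x.
     if \<exists>p. r ! t = Update p x \<and> written_block A r t p x \<noteq> None
     then {update_label r t (actor (r ! t))}
     else shared_labels A r t x)"

text \<open>
  The second part of the union covers both a block that is obtained by the current event and a
  block that was already held. Since a block that leaves the local data gets label set \<open>{}\<close>,
  labels are forgotten with the last local copy.
\<close>

primrec local_labels ::
  "('p, 'o, 'v, 'b, 'pm, 'om) algorithm \<Rightarrow> ('p, 'o, 'v) event list \<Rightarrow> nat \<Rightarrow> 'p \<Rightarrow> 'b \<Rightarrow>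
   label set" where
  "local_labels A r 0 = (\<lambda>p b. {})"
| "local_labels A r (Suc t) = (\<lambda>p b.
     if b \<in> local_blocks A r (Suc t) p
     then local_labels A r t p b \<union>
       \<Union> {shared_labels A r t x | x.
          (r ! t = Get p x \<or> r ! t = Update p x) \<and> shared_block A r t x = b}
     else {})"

definition W :: "('p, 'o, 'v) event list \<Rightarrow> 'v \<Rightarrow> nat set" where
  "W r v = {w. is_write r w v}"

definition L_labels ::
  "('p, 'o, 'v, 'b, 'pm, 'om) algorithm \<Rightarrow> 'p \<Rightarrow> 'v \<Rightarrow> ('p, 'o, 'v) event list \<Rightarrow> nat \<Rightarrow>
   label set" where
  "L_labels A p v r t = (\<Union>b\<in>local_blocks A r t p. local_labels A r t p b) \<inter> (W r v \<times> UNIV)"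

definition disintegrated :: "nat \<Rightarrow> ('p, 'o, 'v, 'b, 'pm, 'om) algorithm \<Rightarrow> bool" where
  "disintegrated \<tau> A \<longleftrightarrow>
     (\<forall>r t p v. run A r \<and> t \<le> length r \<and> is_reader A p \<and> enabled A r t (Return p (Some v)) \<longrightarrow>
        \<tau> \<le> card (L_labels A p v r t))"

text \<open>
  Blocks pertain to the writes that store them: while a reader holds a block, it does not meet the
  same block carrying labels of writes of another value. This holds in particular if different
  writes, or writes of different values, never store the same block. Without such a condition the
  number of values that have a label in the data of a reader is not bounded by the number of
  blocks held: with only one possible block, for instance, a reader never loses a label.
\<close>

definition blocks_pertain_to_one_value :: "('p, 'o, 'v, 'b, 'pm, 'om) algorithm \<Rightarrow> bool" where
  "blocks_pertain_to_one_value A \<longleftrightarrow>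
     (\<forall>r t p b. run A r \<and> t \<le> length r \<and> is_reader A p \<and> b \<in> local_blocks A r t p \<longrightarrow>
        (\<exists>v. local_labels A r t p b \<subseteq> W r v \<times> UNIV))"

end

(*
  A reader whose operation is pending is scheduled against a writer that only writes values of which
  the reader holds no label. If each newly obtained value could be reduced to fewer than \<tau> labels,
  counting the stored and the held ones, the reader would never return. So at some point it holds a
  single label of a value v, and the writer cannot bring the number of stored labels of v below
  \<tau> - 1. The reader is stopped there, which blocks at most L values, and the next reader starts
  after a write of a value that is not blocked; by regularity it can only return such values, so it
  yields another value v. Let k be the minimum in the bound. After k - 1 readers at least two values u
  and w are not blocked. While a write of w replaces u, one of u and w has \<tau> stored labels at every
  time, because any reader that runs alone must return one of them. So at some time w has \<tau> and u
  still has \<tau> - 1 labels, in addition to the labels retained for the k - 1 readers.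
*)
theory Submission
  imports Defs "HOL-Library.Infinite_Set"
begin

section \<open>Runs, configurations and labels when events are appended\<close>

section \<open>Prefixes of runs\<close>

lemma config_append [simp]: "t \<le> length r \<Longrightarrow> config A (r @ e) t = config A r t"
  by (induction t) (simp_all add: nth_append)

lemma pstate_at_append [simp]: "t \<le> length r \<Longrightarrow> pstate_at A (r @ e) t p = pstate_at A r t p"
  by (simp add: pstate_at_def)

lemma ostate_at_append [simp]: "t \<le> length r \<Longrightarrow> ostate_at A (r @ e) t x = ostate_at A r t x"
  by (simp add: ostate_at_def)

lemma local_blocks_append [simp]:
  "t \<le> length r \<Longrightarrow> local_blocks A (r @ e) t p = local_blocks A r t p"
  by (simp add: local_blocks_def)

lemma shared_block_append [simp]:
  "t \<le> length r \<Longrightarrow> shared_block A (r @ e) t x = shared_block A r t x"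
  by (simp add: shared_block_def)

lemma written_block_append [simp]:
  "t \<le> length r \<Longrightarrow> written_block A (r @ e) t p x = written_block A r t p x"
  by (simp add: written_block_def)

lemma pending_append [simp]:
  assumes "t \<le> length r"
  shows "pending (r @ e) t p = pending r t p"
proof -
  have "(r @ e) ! i = r ! i" if "i < t" for i
    using that assms by (simp add: nth_append)
  then show ?thesis
    unfolding pending_def by (simp cong: conj_cong)
qed

lemma current_op_append [simp]:
  assumes "t \<le> length r"
  shows "current_op (r @ e) t p = current_op r t p"
proof -
  have "(\<lambda>i. i < t \<and> (\<exists>x. (r @ e) ! i = Invoke p x)) = (\<lambda>i. i < t \<and> (\<exists>x. r ! i = Invoke p x))"
    using assms by (auto simp: nth_append fun_eq_iff)
  then show ?thesis
    unfolding current_op_def by simp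
qed

lemma update_label_append [simp]:
  assumes "t < length r"
  shows "update_label (r @ e) t p = update_label r t p"
proof -
  have "{j. c < j \<and> j \<le> t \<and> (\<exists>x. (r @ e) ! j = Update p x)} =
      {j. c < j \<and> j \<le> t \<and> (\<exists>x. r ! j = Update p x)}" for c
    using assms by (auto simp: nth_append)
  then show ?thesis
    using assms by (simp add: update_label_def)
qed

lemma shared_labels_append [simp]:
  "t \<le> length r \<Longrightarrow> shared_labels A (r @ e) t = shared_labels A r t"
proof (induction t)
  case (Suc t)
  then have "t < length r" by simp
  then show ?case using Suc.IH by (simp add: nth_append cong: if_cong)
qed simp

lemma local_labels_append [simp]:
  "t \<le> length r \<Longrightarrow> local_labels A (r @ e) t = local_labels A r t"
proof (induction t)
  case (Suc t)
  then have "t < length r" by simp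
  then show ?case
    using Suc by (simp add: nth_append cong: if_cong)
qed simp

lemma enabled_append [simp]: "t \<le> length r \<Longrightarrow> enabled A (r @ e) t x = enabled A r t x"
proof (cases x)
  case (Invoke p y)
  have "(\<exists>j<t. \<exists>y. (r @ e) ! j = Return (writer A) y) \<longleftrightarrow>
      (\<exists>j<t. \<exists>y. r ! j = Return (writer A) y)" if "t \<le> length r"
    using that by (metis nth_append order.strict_trans2)
  moreover assume "t \<le> length r"
  ultimately show ?thesis using Invoke by simp
qed simp_all

declare enabled.simps [simp del]

lemma run_snoc: "run A (r @ [x]) \<longleftrightarrow> run A r \<and> enabled A r (length r) x"
proof -
  have "run A (r @ [x]) \<longleftrightarrow>
      (\<forall>t<length r. enabled A (r @ [x]) t ((r @ [x]) ! t)) \<and>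
      enabled A (r @ [x]) (length r) ((r @ [x]) ! length r)"
    unfolding run_def by (auto simp: less_Suc_eq simp del: enabled_append)
  also have "\<dots> \<longleftrightarrow> run A r \<and> enabled A r (length r) x"
    unfolding run_def by (simp add: nth_append)
  finally show ?thesis .
qed

lemma run_appendD: "run A (r @ e) \<Longrightarrow> run A r"
proof (induction e rule: rev_induct)
  case (snoc x e)
  then show ?case using run_snoc[of A "r @ e" x] by simp
qed simp

lemma run_Nil [simp]: "run A []"
  by (simp add: run_def)

lemma pending_snoc:
  "pending (r @ [x]) (Suc (length r)) p \<longleftrightarrow>
     (\<exists>y. x = Invoke p y) \<or> pending r (length r) p \<and> (\<forall>y. x \<noteq> Return p y)"
  (is "?L \<longleftrightarrow> ?R")
proof
  assume ?L
  then obtain i where i: "i < Suc (length r)" "\<exists>y. (r @ [x]) ! i = Invoke p y"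
    "\<forall>j. i < j \<and> j < Suc (length r) \<longrightarrow> (\<forall>y. (r @ [x]) ! j \<noteq> Return p y)"
    unfolding pending_def by blast
  show ?R
  proof (cases "i = length r")
    case True
    then show ?thesis using i by simp
  next
    case False
    then have il: "i < length r" using i by simp
    have "x \<noteq> Return p y" for y
      using i(3)[rule_format, of "length r" y] il by simp
    moreover have "r ! j \<noteq> Return p y" if "i < j" "j < length r" for j y
      using i(3)[rule_format, of j y] that by (simp add: nth_append)
    moreover have "\<exists>y. r ! i = Invoke p y"
      using i(2) il by (simp add: nth_append)
    ultimately show ?thesis using il unfolding pending_def by blast
  qed
next
  assume ?R
  then show ?L
  proof
    assume "\<exists>y. x = Invoke p y"
    then show ?L unfolding pending_def by (intro exI[of _ "length r"]) auto
  next
    assume *: "pending r (length r) p \<and> (\<forall>y. x \<noteq> Return p y)"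
    then obtain i where "i < length r" "\<exists>y. r ! i = Invoke p y"
      "\<forall>j. i < j \<and> j < length r \<longrightarrow> (\<forall>y. r ! j \<noteq> Return p y)"
      unfolding pending_def by blast
    with * show ?L
      unfolding pending_def by (intro exI[of _ i]) (auto simp: nth_append)
  qed
qed

lemma run_prefix_chain:
  assumes "\<And>n. \<exists>e. g (Suc n) = g n @ e" "m \<le> n"
  shows "\<exists>e. g n = g m @ e"
  using assms(2)
proof (induction n rule: dec_induct)
  case (step n)
  then show ?case using assms(1)[of n] by auto
qed simp

section \<open>From infinite runs to finite completions\<close>

section \<open>Wait-freedom\<close>

text \<open>Repeated extension by dependent choice yields growing finite runs. Their limit is an
  infinite run in which \<open>p\<close> acts infinitely often while the operation pending in
  \<open>r0\<close> never returns. Later arguments thus only have to supply an invariant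
  \<open>P\<close> and one extension step.\<close>

lemma no_endless_operation:
  fixes r0 :: "('p, 'o, 'v) event list"
  assumes wf: "wait_free A" and pend: "pending r0 (length r0) p" and "P r0"
    and P_run: "\<And>r. P r \<Longrightarrow> run A r"
    and P_step: "\<And>r. P r \<Longrightarrow>
      \<exists>e. P (r @ e) \<and> (\<exists>x\<in>set e. actor x = p) \<and> (\<forall>y. Return p y \<notin> set e)"
  shows False
proof -
  define Q where "Q r r' \<longleftrightarrow>
    (\<exists>e. r' = r @ e \<and> (\<exists>x\<in>set e. actor x = p) \<and> (\<forall>y. Return p y \<notin> set e))"
    for r r' :: "('p, 'o, 'v) event list"
  have "\<exists>g. \<forall>n. (P (g n) \<and> (n = 0 \<longrightarrow> g n = r0)) \<and> Q (g n) (g (Suc n))"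
  proof (rule dependent_nat_choice[where P = "\<lambda>n r. P r \<and> (n = 0 \<longrightarrow> r = r0)" and Q = "\<lambda>_. Q"])
    show "\<exists>x. P x \<and> ((0::nat) = 0 \<longrightarrow> x = r0)" using \<open>P r0\<close> by auto
  next
    fix x and n :: nat
    assume "P x \<and> (n = 0 \<longrightarrow> x = r0)"
    then show "\<exists>y. (P y \<and> (Suc n = 0 \<longrightarrow> y = r0)) \<and> Q x y"
      using P_step[of x] unfolding Q_def by blast
  qed
  then obtain g where gP: "\<And>n. P (g n)" and g0: "g 0 = r0" and gQ: "\<And>n. Q (g n) (g (Suc n))"
    by blast
  have chain: "\<exists>e. g n = g m @ e" if "m \<le> n" for m n
    using run_prefix_chain[OF _ that, of g] gQ unfolding Q_def by blast
  have len: "n \<le> length (g n)" for n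
  proof (induction n)
    case (Suc n)
    obtain e where "g (Suc n) = g n @ e" "e \<noteq> []"
      using gQ[of n] unfolding Q_def by (metis empty_iff empty_set)
    then show ?case using Suc by (cases e) auto
  qed simp
  \<comment> \<open>By \<open>len\<close>, stage \<open>Suc t\<close> already contains position
    \<open>t\<close>, and later stages only append, so \<open>f\<close> agrees with every
    \<open>g n\<close> on its whole length.\<close>
  define f where "f t = g (Suc t) ! t" for t
  have f_eq: "f t = g n ! t" if "t < length (g n)" for t n
  proof (cases "Suc t \<le> n")
    case True
    then obtain e where "g n = g (Suc t) @ e" using chain by blast
    then show ?thesis using len[of "Suc t"] by (simp add: f_def nth_append)
  next
    case False
    then obtain e where "g (Suc t) = g n @ e" using chain[of n "Suc t"] by auto
    then show ?thesis using that by (simp add: f_def nth_append)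
  qed
  have "infinite_run A f"
    unfolding infinite_run_def
  proof
    fix t
    have "map f [0..<t] = take t (g t)"
      by (rule nth_equalityI) (use len[of t] in \<open>auto simp: f_eq[of _ t]\<close>)
    moreover have "run A (take t (g t))"
      using P_run[OF gP[of t]] by (metis append_take_drop_id run_appendD)
    ultimately show "run A (map f [0..<t])" by simp
  qed
  moreover obtain i x where i: "i < length r0" "r0 ! i = Invoke p x"
    "\<And>j y. i < j \<Longrightarrow> j < length r0 \<Longrightarrow> r0 ! j \<noteq> Return p y"
    using pend unfolding pending_def by blast
  have no_ret: "g n ! j \<noteq> Return p y" if "i < j" "j < length (g n)" for n j y
    using that
  proof (induction n)
    case 0
    then show ?case using i g0 by simp
  next
    case (Suc n)
    obtain e where e: "g (Suc n) = g n @ e" "\<forall>y. Return p y \<notin> set e"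
      using gQ[of n] unfolding Q_def by blast
    show ?case
    proof (cases "j < length (g n)")
      case True
      then show ?thesis using Suc e by (simp add: nth_append)
    next
      case False
      then have "g (Suc n) ! j \<in> set e"
        using Suc.prems e by (auto simp: nth_append)
      then show ?thesis using e by metis
    qed
  qed
  have "f i = Invoke p x" using f_eq[of i 0] i g0 by simp
  moreover have "infinite {j. actor (f j) = p}"
    unfolding infinite_nat_iff_unbounded_le
  proof
    fix n
    obtain e x where e: "g (Suc n) = g n @ e" "x \<in> set e" "actor x = p"
      using gQ[of n] unfolding Q_def by blast
    then obtain k where k: "k < length e" "e ! k = x" by (meson in_set_conv_nth)
    have "f (length (g n) + k) = x"
      using f_eq[of "length (g n) + k" "Suc n"] e k by simp
    then show "\<exists>m\<ge>n. m \<in> {j. actor (f j) = p}"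
      using e len[of n] by (intro exI[of _ "length (g n) + k"]) auto
  qed
  ultimately obtain j y where "j > i" "f j = Return p y"
    using wf unfolding wait_free_def by blast
  then show False
    using no_ret[of j "Suc j" y] f_eq[of j "Suc j"] len[of "Suc j"]
    by (metis Suc_le_lessD)
qed

text \<open>A pending process always has an enabled action. If none of its solo extensions led to a
  return, it could perform gets and updates alone forever.\<close>

lemma solo_completion:
  fixes r :: "('p, 'o, 'v) event list"
  assumes wf: "wait_free A" and run: "run A r" and pend: "pending r (length r) p"
  shows "\<exists>s y. run A (r @ s @ [Return p y]) \<and>
    (\<forall>x\<in>set s. \<exists>o'. x = Get p o' \<or> x = Update p o')"
proof (rule ccontr)
  assume contra: "\<not> ?thesis"
  define solo where "solo s \<longleftrightarrow> (\<forall>x\<in>set s. \<exists>o'. x = Get p o' \<or> x = Update p o')"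
    for s :: "('p, 'o, 'v) event list"
  define P where "P r' \<longleftrightarrow> run A r' \<and> pending r' (length r') p \<and> (\<exists>s. r' = r @ s \<and> solo s)" for r'
  show False
  proof (rule no_endless_operation[OF wf pend, of P])
    show "P r" using run pend by (simp add: P_def solo_def)
    show "P r' \<Longrightarrow> run A r'" for r' by (simp add: P_def)
  next
    fix r' assume "P r'"
    then obtain s where P: "run A r'" "pending r' (length r') p" "r' = r @ s" "solo s"
      unfolding P_def by blast
    have *: "\<exists>x. enabled A r' (length r') x \<and> (\<exists>o'. x = Get p o' \<or> x = Update p o')"
    proof (cases "next_action A p (pstate_at A r' (length r') p)")
      case (DoGet o')
      then show ?thesis using P by (intro exI[of _ "Get p o'"]) (auto simp: enabled.simps)
    next
      case (DoUpdate o')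
      then show ?thesis using P by (intro exI[of _ "Update p o'"]) (auto simp: enabled.simps)
    next
      case (DoReturn y)
      then have "run A (r' @ [Return p y])" using P(1,2) by (simp add: run_snoc enabled.simps)
      then have False using contra P(3,4) unfolding solo_def append_assoc by (metis append_assoc)
      then show ?thesis ..
    qed
    then obtain x where x: "enabled A r' (length r') x" "\<exists>o'. x = Get p o' \<or> x = Update p o'"
      by blast
    then have "run A (r' @ [x])" "pending (r' @ [x]) (length (r' @ [x])) p"
      using P(1,2) by (auto simp: run_snoc pending_snoc)
    then have "P (r' @ [x])"
      using x(2) P(3,4) unfolding P_def solo_def
      by (intro conjI exI[of _ "s @ [x]"]) auto
    then show "\<exists>e. P (r' @ e) \<and> (\<exists>x\<in>set e. actor x = p) \<and> (\<forall>y. Return p y \<notin> set e)"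
      using x(2) by (intro exI[of _ "[x]"]) auto
  qed
qed

section \<open>Labels and the operations they name\<close>

section \<open>Labels in shared and local storage\<close>

lemma shared_labels_snoc:
  "shared_labels A (r @ [e]) (Suc (length r)) x =
    (if \<exists>p. e = Update p x \<and> written_block A r (length r) p x \<noteq> None
     then {update_label (r @ [e]) (length r) (actor e)} else shared_labels A r (length r) x)"
  by (simp add: nth_append cong: if_cong)

lemma local_labels_snoc:
  "local_labels A (r @ [e]) (Suc (length r)) p b =
    (if b \<in> local_blocks A (r @ [e]) (Suc (length r)) p
     then local_labels A r (length r) p b \<union>
       \<Union> {shared_labels A r (length r) x | x.
          (e = Get p x \<or> e = Update p x) \<and> shared_block A r (length r) x = b}
     else {})"
  by (simp add: nth_append cong: if_cong)

declare shared_labels.simps(2) [simp del] local_labels.simps(2) [simp del]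

lemma current_op_pending:
  assumes "pending r t p"
  shows "current_op r t p < t \<and> (\<exists>x. r ! current_op r t p = Invoke p x)"
  unfolding current_op_def
proof (rule GreatestI_ex_nat[where b = t])
  show "\<exists>i. i < t \<and> (\<exists>x. r ! i = Invoke p x)"
    using assms unfolding pending_def by blast
qed auto

lemma current_op_ge:
  assumes "i < t" "r ! i = Invoke p x"
  shows "i \<le> current_op r t p"
  unfolding current_op_def
  by (rule Greatest_le_nat[where b = t]) (use assms in auto)

text \<open>No invocation inside \<open>r\<close> is still open, so the operation now pending was
  invoked in \<open>e\<close>. This tells which values the writer can be storing.\<close>

lemma current_op_after_idle:
  assumes "\<not> pending r (length r) p" "pending (r @ e) (length (r @ e)) p"
  shows "length r \<le> current_op (r @ e) (length (r @ e)) p"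
proof -
  obtain i x where i: "i < length (r @ e)" "(r @ e) ! i = Invoke p x"
    "\<forall>j. i < j \<and> j < length (r @ e) \<longrightarrow> (\<forall>y. (r @ e) ! j \<noteq> Return p y)"
    using assms(2) unfolding pending_def by blast
  have "length r \<le> i"
  proof (rule ccontr)
    assume "\<not> length r \<le> i"
    then have il: "i < length r" by simp
    have "r ! j \<noteq> Return p y" if "i < j" "j < length r" for j y
      using i(3)[rule_format, of j y] that by (simp add: nth_append)
    moreover have "r ! i = Invoke p x" using i(2) il by (simp add: nth_append)
    ultimately have "pending r (length r) p" using il unfolding pending_def by blast
    then show False using assms(1) by simp
  qed
  also have "i \<le> current_op (r @ e) (length (r @ e)) p"
    using current_op_ge[OF i(1,2)] .
  finally show ?thesis .
qed

lemma W_append: "w < length r \<Longrightarrow> w \<in> W (r @ e) v \<longleftrightarrow> w \<in> W r v"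
  by (simp add: W_def is_write_def nth_append)

lemma W_disjoint: "w \<in> W r v \<Longrightarrow> w \<in> W r v' \<Longrightarrow> v = v'"
  by (auto simp: W_def is_write_def)

lemma card_shared_labels: "finite (shared_labels A r t x) \<and> card (shared_labels A r t x) \<le> 1"
  by (induction t) (auto simp: shared_labels.simps(2))

text \<open>A label names an invocation that precedes the storing update. Hence later events cannot
  change the value to which it belongs, although \<open>W\<close> refers to the whole run.\<close>

lemma shared_labels_bound:
  assumes "run A r" "t \<le> length r" "(w, k) \<in> shared_labels A r t x"
  shows "w < t"
  using assms(2,3)
proof (induction t)
  case (Suc t)
  show ?case
  proof (cases "\<exists>p. r ! t = Update p x \<and> written_block A r t p x \<noteq> None")
    case True
    then obtain p where p: "r ! t = Update p x" by blast
    have "enabled A r t (r ! t)" using assms(1) Suc.prems by (simp add: run_def)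
    then have "pending r t p" using p by (simp add: enabled.simps)
    moreover have "w = current_op r t p"
      using Suc.prems(2) True p by (simp add: update_label_def shared_labels.simps(2))
    ultimately show ?thesis using current_op_pending[of r t p] by simp
  next
    case False
    then have "(w, k) \<in> shared_labels A r t x" using Suc.prems(2) by (simp add: shared_labels.simps(2) split: if_splits)
    then show ?thesis using Suc.IH Suc.prems by simp
  qed
qed simp

lemma local_labels_bound:
  assumes "run A r" "t \<le> length r" "(w, k) \<in> local_labels A r t p b"
  shows "w < t"
  using assms(2,3)
proof (induction t)
  case (Suc t)
  then have "(w, k) \<in> local_labels A r t p b \<or> (\<exists>x. (w, k) \<in> shared_labels A r t x)"
    by (auto simp: local_labels.simps(2) split: if_splits)
  then show ?case
    using Suc.IH Suc.prems shared_labels_bound[OF assms(1), of t w k] by fastforce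
qed simp

lemma local_labels_not_held: "b \<notin> local_blocks A r t p \<Longrightarrow> local_labels A r t p b = {}"
  by (cases t) (simp_all add: local_labels.simps(2))

lemma L_labels_alt: "L_labels A p v r t = (\<Union>b. local_labels A r t p b) \<inter> (W r v \<times> UNIV)"
proof -
  have "(\<Union>b. local_labels A r t p b) = (\<Union>b\<in>local_blocks A r t p. local_labels A r t p b)"
    using local_labels_not_held[of _ A r t p] by fastforce
  then show ?thesis by (simp add: L_labels_def)
qed

section \<open>Counting the labels stored for a value\<close>

abbreviation held_labels where "held_labels A p v r \<equiv> L_labels A p v r (length r)"

text \<open>The counterpart of \<open>L_labels\<close> for the shared storage, always taken at the
  end of \<open>r\<close>.\<close>

definition stored_labels ::
  "('p, 'o, 'v, 'b, 'pm, 'om) algorithm \<Rightarrow> ('p, 'o, 'v) event list \<Rightarrow> 'v \<Rightarrow> label set" where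
  "stored_labels A r v = (\<Union>x. shared_labels A r (length r) x) \<inter> (W r v \<times> UNIV)"

lemma finite_stored_labels:
  fixes A :: "('p, 'o::finite, 'v, 'b, 'pm, 'om) algorithm"
  shows "finite (stored_labels A r v)"
  using card_shared_labels[of A r] by (auto simp: stored_labels_def)

text \<open>Label sets of distinct values are disjoint, since a write has one value, and each object
  contributes at most one label. This converts label counts into a bound on the number of
  objects.\<close>

lemma sum_card_stored_labels:
  fixes A :: "('p, 'o::finite, 'v, 'b, 'pm, 'om) algorithm"
  assumes "finite V"
  shows "(\<Sum>v\<in>V. card (stored_labels A r v)) \<le> CARD('o)"
proof -
  have "(\<Sum>v\<in>V. card (stored_labels A r v)) = card (\<Union>v\<in>V. stored_labels A r v)"
    by (rule card_UN_disjoint[symmetric])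
      (use assms finite_stored_labels in \<open>auto simp: stored_labels_def dest: W_disjoint\<close>)
  also have "\<dots> \<le> card (\<Union>x. shared_labels A r (length r) x)"
    by (rule card_mono) (use card_shared_labels[of A r] in \<open>auto simp: stored_labels_def\<close>)
  also have "\<dots> \<le> (\<Sum>x\<in>UNIV. card (shared_labels A r (length r) x))"
    by (rule card_UN_le) simp
  also have "\<dots> \<le> (\<Sum>x\<in>(UNIV::'o set). 1)"
    by (rule sum_mono) (use card_shared_labels[of A r] in auto)
  finally show ?thesis by simp
qed

lemma finite_local_labels:
  fixes A :: "('p, 'o::finite, 'v, 'b, 'pm, 'om) algorithm"
  shows "finite (\<Union>b. local_labels A r t p b)"
proof (induction t)
  case (Suc t)
  have "(\<Union>b. local_labels A r (Suc t) p b) \<subseteq>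
      (\<Union>b. local_labels A r t p b) \<union> (\<Union>x. shared_labels A r t x)"
    by (auto simp: local_labels.simps(2) split: if_splits)
  moreover have "finite (\<Union>x. shared_labels A r t x)"
    using card_shared_labels[of A r t] by auto
  ultimately show ?case using Suc by (meson finite_UnI finite_subset)
qed simp

lemma finite_L_labels:
  fixes A :: "('p, 'o::finite, 'v, 'b, 'pm, 'om) algorithm"
  shows "finite (L_labels A p v r t)"
  using finite_local_labels[of A r t p] by (simp add: L_labels_alt)

lemma restrict_W_snoc:
  assumes "\<And>w k. (w, k) \<in> S \<Longrightarrow> w < length r"
  shows "S \<inter> (W (r @ e) v \<times> UNIV) = S \<inter> (W r v \<times> UNIV)"
proof (rule set_eqI)
  fix l
  show "l \<in> S \<inter> (W (r @ e) v \<times> UNIV) \<longleftrightarrow> l \<in> S \<inter> (W r v \<times> UNIV)"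
    using assms[of "fst l" "snd l"] W_append[of "fst l" r e v] by (cases l) auto
qed

lemma stored_labels_append_W:
  assumes "run A r"
  shows "(\<Union>x. shared_labels A r (length r) x) \<inter> (W (r @ e) v \<times> UNIV) = stored_labels A r v"
  unfolding stored_labels_def
  by (rule restrict_W_snoc) (use shared_labels_bound[OF assms] in auto)

text \<open>An event affects the label set of at most one object, and that set has at most one
  element.\<close>

lemma card_stored_labels_snoc:
  fixes A :: "('p, 'o::finite, 'v, 'b, 'pm, 'om) algorithm"
  assumes "run A r"
  shows "card (stored_labels A r v) \<le> card (stored_labels A (r @ [e]) v) + 1"
proof -
  obtain x where x: "\<And>y. y \<noteq> x \<Longrightarrow>
      shared_labels A (r @ [e]) (Suc (length r)) y = shared_labels A r (length r) y"
  proof (cases e)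
    case (Update p x)
    then show ?thesis using that[of x] by (simp add: shared_labels_snoc)
  qed (use that in \<open>simp_all add: shared_labels_snoc\<close>)
  let ?S = "shared_labels A r (length r) x"
  have "stored_labels A r v \<subseteq> stored_labels A (r @ [e]) v \<union> ?S"
  proof
    fix l assume l: "l \<in> stored_labels A r v"
    then obtain y where "l \<in> shared_labels A r (length r) y" unfolding stored_labels_def by blast
    moreover have "l \<in> W (r @ [e]) v \<times> UNIV"
      using l stored_labels_append_W[OF assms, of "[e]" v] by blast
    ultimately show "l \<in> stored_labels A (r @ [e]) v \<union> ?S"
      using x[of y] unfolding stored_labels_def length_append_singleton by (cases "y = x") auto
  qed
  then have "card (stored_labels A r v) \<le> card (stored_labels A (r @ [e]) v \<union> ?S)"
    using finite_stored_labels[of A "r @ [e]" v] card_shared_labels[of A r "length r" x]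
    by (intro card_mono) auto
  also have "\<dots> \<le> card (stored_labels A (r @ [e]) v) + card ?S"
    by (rule card_Un_le)
  finally show ?thesis using card_shared_labels[of A r "length r" x] by linarith
qed

lemma stored_labels_snoc_no_write:
  assumes "run A r" "\<And>p x. e = Update p x \<Longrightarrow> written_block A r (length r) p x = None"
  shows "stored_labels A (r @ [e]) v = stored_labels A r v"
proof -
  have "shared_labels A (r @ [e]) (Suc (length r)) x = shared_labels A r (length r) x" for x
    using assms(2) by (auto simp: shared_labels_snoc)
  then show ?thesis
    using stored_labels_append_W[OF assms(1), of "[e]" v] unfolding stored_labels_def by simp
qed

text \<open>A newly stored block gets the label of the current operation of \<open>p\<close>, which
  is no write of \<open>v\<close>, so the event can only overwrite labels of
  \<open>v\<close>.\<close>

lemma stored_labels_snoc_other_value: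
  assumes "run A (r @ [e])" "actor e = p" "pending r (length r) p \<Longrightarrow> current_op r (length r) p \<notin> W r v"
  shows "stored_labels A (r @ [e]) v \<subseteq> stored_labels A r v"
proof -
  have en: "enabled A r (length r) e" and r: "run A r" using assms(1) by (auto simp: run_snoc)
  show ?thesis
  proof
    fix l assume l: "l \<in> stored_labels A (r @ [e]) v"
    then obtain y where y: "l \<in> shared_labels A (r @ [e]) (Suc (length r)) y" "l \<in> W (r @ [e]) v \<times> UNIV"
      unfolding stored_labels_def length_append_singleton by blast
    show "l \<in> stored_labels A r v"
    proof (cases "e = Update p y \<and> written_block A r (length r) p y \<noteq> None")
      case True
      then have "pending r (length r) p" using en by (simp add: enabled.simps)
      moreover have "l = update_label (r @ [e]) (length r) p"
        using y(1) True unfolding shared_labels_snoc by (auto split: if_splits)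
      ultimately have "fst l = current_op r (length r) p" "fst l < length r" "fst l \<notin> W r v"
        using current_op_pending[of r "length r" p] assms(3) by (auto simp: update_label_def)
      then show ?thesis using y W_append[of "fst l" r "[e]" v] by (auto simp: mem_Times_iff)
    next
      case False
      then have "l \<in> shared_labels A r (length r) y"
        using y(1) assms(2) unfolding shared_labels_snoc by (auto split: if_splits)
      then show ?thesis
        using y(2) stored_labels_append_W[OF r, of "[e]" v] by blast
    qed
  qed
qed

lemma reader_writes_no_block:
  assumes emul: "register_emulation A" and run: "run A (r @ [Update p x])" and "is_reader A p"
  shows "written_block A r (length r) p x = None"
proof -
  have "(r @ [Update p x]) ! length r = Update p x" by simp
  then have "written_block A (r @ [Update p x]) (length r) p x = None"
    using assms unfolding register_emulation_def by (metis length_append_singleton lessI)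
  then show ?thesis by simp
qed

text \<open>The writer is idle after \<open>r\<close>, so any operation it has pending later was
  invoked in \<open>e @ s\<close> and does not write \<open>v\<close>; readers store no blocks.
  Splitting off \<open>e\<close> lets the comparison start in the middle of a write.\<close>

lemma stored_labels_antimono:
  assumes emul: "register_emulation A" and run: "run A (r @ e @ s)"
    and idle: "\<not> pending r (length r) (writer A)"
    and avoid: "\<And>p. Invoke p (Write v) \<notin> set (e @ s)"
  shows "stored_labels A (r @ e @ s) v \<subseteq> stored_labels A (r @ e) v"
  using run avoid
proof (induction s rule: rev_induct)
  case (snoc x s)
  let ?r = "r @ e @ s"
  have run: "run A ?r" using snoc.prems(1) run_appendD[of A ?r "[x]"] by simp
  have "stored_labels A (?r @ [x]) v \<subseteq> stored_labels A ?r v"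
  proof (cases "actor x = writer A")
    case True
    show ?thesis
    proof (rule stored_labels_snoc_other_value[OF _ True])
      show "run A (?r @ [x])" using snoc.prems(1) by simp
      assume pend: "pending ?r (length ?r) (writer A)"
      let ?c = "current_op ?r (length ?r) (writer A)"
      have c: "length r \<le> ?c" "?c < length ?r"
        using current_op_after_idle[OF idle pend] current_op_pending[OF pend] by auto
      then have "(e @ s) ! (?c - length r) \<in> set (e @ s)" by (intro nth_mem) auto
      then have "?r ! ?c \<in> set (e @ s)" using c by (simp add: nth_append_right)
      then have "?r ! ?c \<noteq> Invoke q (Write v)" for q
        using snoc.prems(2)[of q] by auto
      then show "?c \<notin> W ?r v"
        by (simp add: W_def is_write_def)
    qed
  next
    case False
    have "written_block A ?r (length ?r) p y = None" if "x = Update p y" for p y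
      using reader_writes_no_block[OF emul, of ?r p y] False that snoc.prems(1)
      by (simp add: is_reader_def)
    then show ?thesis using stored_labels_snoc_no_write[OF run, of x v] by blast
  qed
  moreover have "stored_labels A ?r v \<subseteq> stored_labels A (r @ e) v"
    using snoc.IH[OF run] snoc.prems(2) by simp
  ultimately show ?case by simp
qed simp

lemma stored_labels_readers:
  assumes emul: "register_emulation A" and run: "run A (r @ e)"
    and readers: "\<And>x. x \<in> set e \<Longrightarrow> is_reader A (actor x)"
  shows "stored_labels A (r @ e) v = stored_labels A r v"
  using run readers
proof (induction e rule: rev_induct)
  case (snoc x e)
  have run: "run A (r @ e)" using snoc.prems(1) run_appendD[of A "r @ e" "[x]"] by simp
  have "written_block A (r @ e) (length (r @ e)) p y = None" if "x = Update p y" for p y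
    using reader_writes_no_block[OF emul, of "r @ e" p y] that snoc.prems(1) snoc.prems(2)[of x] by simp
  then have "stored_labels A ((r @ e) @ [x]) v = stored_labels A (r @ e) v"
    using stored_labels_snoc_no_write[OF run] by blast
  then show ?case using snoc run by simp
qed simp

section \<open>Labels held by one process\<close>

lemma held_labels_append_W:
  assumes "run A r"
  shows "(\<Union>b. local_labels A r (length r) p b) \<inter> (W (r @ e) v \<times> UNIV) = held_labels A p v r"
  unfolding L_labels_alt
  by (rule restrict_W_snoc) (use local_labels_bound[OF assms] in auto)

lemma held_labels_other_process:
  assumes run: "run A (r @ e)" and other: "\<And>x. x \<in> set e \<Longrightarrow> actor x \<noteq> p"
  shows "held_labels A p v (r @ e) = held_labels A p v r"
  using run other
proof (induction e rule: rev_induct)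
  case (snoc x e)
  let ?r = "r @ e"
  have run: "run A ?r" using snoc.prems(1) run_appendD[of A ?r "[x]"] by simp
  have "procs (step A x c) p = procs c p" for c
    using snoc.prems(2)[of x] by (cases x) (auto split: prod.splits)
  then have "local_blocks A (?r @ [x]) (Suc (length ?r)) p = local_blocks A ?r (length ?r) p"
    unfolding local_blocks_def pstate_at_def by (simp add: nth_append del: append_assoc)
  moreover have "x \<noteq> Get p y \<and> x \<noteq> Update p y" for y using snoc.prems(2)[of x] by auto
  ultimately have "local_labels A (?r @ [x]) (Suc (length ?r)) p b = local_labels A ?r (length ?r) p b" for b
    using local_labels_not_held[of b A ?r "length ?r" p] unfolding local_labels_snoc by auto
  then have "held_labels A p v (?r @ [x]) = held_labels A p v ?r"
    using held_labels_append_W[OF run, of p "[x]" v] by (simp add: L_labels_alt)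
  then show ?case using snoc run by simp
qed simp

text \<open>An access exposes the reader to the labels of one object only. Keeping the set of
  \<open>x\<close> in the bound, besides the stored labels, later shows that one access yields at
  most one new label.\<close>

lemma held_labels_access:
  assumes run: "run A r" and e: "e = Get p x \<or> e = Update p x"
  shows "held_labels A p v (r @ [e]) \<subseteq>
    held_labels A p v r \<union> (stored_labels A r v \<inter> shared_labels A r (length r) x)"
proof -
  have "(\<Union>b. local_labels A (r @ [e]) (Suc (length r)) p b) \<subseteq>
      (\<Union>b. local_labels A r (length r) p b) \<union> shared_labels A r (length r) x"
    using e unfolding local_labels_snoc by (auto split: if_splits)
  from Int_mono[OF this subset_refl, of "W (r @ [e]) v \<times> UNIV"]
  have "held_labels A p v (r @ [e]) \<subseteq>
      held_labels A p v r \<union> shared_labels A r (length r) x \<inter> (W (r @ [e]) v \<times> UNIV)"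
    unfolding Int_Un_distrib2 held_labels_append_W[OF run]
    by (simp add: L_labels_alt[of A p v "r @ [e]"])
  moreover have "shared_labels A r (length r) x \<inter> (W (r @ [e]) v \<times> UNIV) \<subseteq>
      stored_labels A r v \<inter> shared_labels A r (length r) x"
    unfolding stored_labels_append_W[OF run, of "[e]" v, symmetric] by auto
  ultimately show ?thesis by blast
qed

text \<open>Local data is empty when the read is invoked, and the invocation accesses no object, so
  even blocks placed by \<open>on_invoke\<close> carry no label.\<close>

lemma held_labels_invoke_read:
  assumes emul: "register_emulation A" and run: "run A (r @ [Invoke p Read])"
  shows "held_labels A p v (r @ [Invoke p Read]) = {}"
proof -
  have "(r @ [Invoke p Read]) ! length r = Invoke p Read" by simp
  then have "local_blocks A (r @ [Invoke p Read]) (length r) p = {}"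
    using emul run unfolding register_emulation_def by (metis length_append_singleton lessI)
  then have "local_blocks A r (length r) p = {}" by simp
  then have "local_labels A r (length r) p b = {}" for b by (simp add: local_labels_not_held)
  then have "local_labels A (r @ [Invoke p Read]) (Suc (length r)) p b = {}" for b
    unfolding local_labels_snoc by simp
  then show ?thesis unfolding L_labels_alt by simp
qed

section \<open>Completed operations and the values a later read may return\<close>

section \<open>Complete operations\<close>

lemma pending_other_process:
  assumes "\<And>x. x \<in> set e \<Longrightarrow> actor x \<noteq> p"
  shows "pending (r @ e) (length (r @ e)) p = pending r (length r) p"
  using assms
proof (induction e rule: rev_induct)
  case (snoc x e)
  have "pending ((r @ e) @ [x]) (Suc (length (r @ e))) p = pending (r @ e) (length (r @ e)) p"
    unfolding pending_snoc using snoc.prems[of x] by auto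
  then show ?case using snoc by simp
qed simp

lemma run_invoke_write:
  assumes "run A r" "i < length r" "r ! i = Invoke p (Write v)"
  shows "p = writer A"
proof -
  have "enabled A r i (r ! i)" using assms(1,2) unfolding run_def by blast
  then show ?thesis using assms(3) by (auto simp: enabled.simps is_reader_def split: if_splits)
qed

lemma returns_at_le:
  assumes "returns_at r i j" "r ! i = Invoke p x" "i < k" "r ! k = Return p y"
  shows "j \<le> k"
  using assms unfolding returns_at_def by (metis event.inject(1) linorder_not_le)

lemma returns_at_exists:
  assumes "r ! i = Invoke p x" "i < k" "k < length r" "r ! k = Return p y"
  shows "\<exists>j\<le>k. returns_at r i j"
proof -
  let ?P = "\<lambda>j. i < j \<and> (\<exists>y. r ! j = Return p y)"
  have P: "?P (LEAST j. ?P j)" by (rule LeastI[of ?P k]) (use assms in auto)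
  have le: "(LEAST j. ?P j) \<le> k" by (rule Least_le) (use assms in auto)
  have "r ! m \<noteq> Return p y" if "i < m" "m < (LEAST j. ?P j)" for m y
    using not_less_Least[OF that(2)] that(1) by blast
  then have "returns_at r i (LEAST j. ?P j)"
    using P le assms unfolding returns_at_def by auto
  then show ?thesis using le by blast
qed

lemma returns_at_append: "returns_at r i j \<Longrightarrow> returns_at (r @ e) i j"
  by (auto simp: returns_at_def nth_append)

lemma returns_at_solo:
  assumes s: "\<And>x. x \<in> set s \<Longrightarrow> \<exists>o'. x = Get p o' \<or> x = Update p o'"
  shows "returns_at (r @ Invoke p x # s @ [Return p y]) (length r) (length r + length s + 1)"
proof -
  let ?r = "r @ Invoke p x # s @ [Return p y]"
  have "?r ! k \<noteq> Return p y'" if "length r < k" "k < length r + length s + 1" for k y'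
  proof -
    have "?r ! k \<in> set s" using that by (auto simp: nth_append nth_Cons')
    then show ?thesis using s by fastforce
  qed
  moreover have "?r ! length r = Invoke p x" "?r ! (length r + length s + 1) = Return p y"
    by (auto simp: nth_append)
  ultimately show ?thesis unfolding returns_at_def by auto
qed

text \<open>Here \<open>n\<close> is the length of a prefix. If the writer is idle after that
  prefix, such a write cuts later reads off from the values written only in the prefix.\<close>

definition write_completed :: "nat \<Rightarrow> ('p, 'o, 'v) event list \<Rightarrow> bool" where
  "write_completed n r \<longleftrightarrow> (\<exists>w v j. n \<le> w \<and> is_write r w v \<and> returns_at r w j)"

lemma write_completed_append: "write_completed n r \<Longrightarrow> write_completed n (r @ e)"
  unfolding write_completed_def is_write_def
  by (metis length_append nth_append returns_at_append trans_less_add1)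

text \<open>This is the condition under which \<open>enabled\<close> admits invocations after time
  0.\<close>

definition initialized where
  "initialized A r \<longleftrightarrow> (\<exists>j<length r. \<exists>y. r ! j = Return (writer A) y)"

lemma initialized_append: "initialized A r \<Longrightarrow> initialized A (r @ e)"
  unfolding initialized_def by (metis length_append nth_append trans_less_add1)

lemma write_completed_initialized:
  assumes "run A r" "write_completed n r"
  shows "initialized A r"
proof -
  obtain w v j where w: "is_write r w v" "returns_at r w j"
    using assms(2) unfolding write_completed_def by blast
  then obtain p where "w < length r" "r ! w = Invoke p (Write v)" unfolding is_write_def by blast
  then have "p = writer A" using run_invoke_write[OF assms(1)] by blast
  then show ?thesis
    using w(2) \<open>r ! w = _\<close> unfolding returns_at_def initialized_def by (metis event.inject(1))
qed

text \<open>
  A read that starts after the completion of a write in \<open>e\<close> cannot return a value that is written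
  only in \<open>r\<close>: all writes of \<open>r\<close> have returned before that write was invoked.
\<close>

lemma read_value_recent:
  assumes reg: "regular A" and run: "run A (r @ e)"
    and idle: "\<not> pending r (length r) (writer A)"
    and w: "length r \<le> w" "is_write (r @ e) w u" "returns_at (r @ e) w j" "j < i"
    and read: "(r @ e) ! i = Invoke p Read" "returns_at (r @ e) i k" "(r @ e) ! k = Return p y"
  shows "\<exists>v q. y = Some v \<and> Invoke q (Write v) \<in> set e"
proof -
  let ?r = "r @ e"
  obtain v w' where v: "y = Some v" "is_write ?r w' v"
    and or: "last_write_before ?r w' i \<or> concurrent ?r w' i"
    using reg run read unfolding regular_def by blast
  obtain q where q: "w' < length ?r" "?r ! w' = Invoke q (Write v)"
    using v(2) unfolding is_write_def by blast
  have "length r \<le> w'"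
  proof (rule ccontr)
    assume "\<not> length r \<le> w'"
    then have old: "w' < length r" "r ! w' = Invoke q (Write v)"
      using q by (auto simp: nth_append)
    have "q = writer A" using run_invoke_write[OF run q] .
    then obtain k0 y0 where k0: "w' < k0" "k0 < length r" "r ! k0 = Return q y0"
      using idle old unfolding pending_def by blast
    then have k0': "?r ! k0 = Return q y0" by (simp add: nth_append)
    have "w < j" using w(3) by (simp add: returns_at_def)
    \<comment> \<open>Regularity would require \<open>w'\<close> to return no earlier than
      \<open>j\<close>, or the read to start before \<open>k0\<close>; but \<open>j\<close> and
      \<open>i\<close> lie beyond \<open>r\<close>, while \<open>k0\<close> lies within it.\<close>
    show False
      using or
    proof
      assume "last_write_before ?r w' i"
      then obtain j' where "returns_at ?r w' j'" "j \<le> j'"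
        using w unfolding last_write_before_def by blast
      moreover have "j' \<le> k0"
        using returns_at_le[OF \<open>returns_at ?r w' j'\<close> q(2) k0(1) k0'] .
      ultimately show False using \<open>w < j\<close> w(1) k0(2) by linarith
    next
      assume conc: "concurrent ?r w' i"
      have "k0 < length ?r" using k0(2) by simp
      then obtain j' where "j' \<le> k0" "returns_at ?r w' j'"
        using returns_at_exists[OF q(2) k0(1) _ k0'] by blast
      then have "i < k0" using conc unfolding concurrent_def by fastforce
      then show False using \<open>w < j\<close> w(1,4) k0(2) by linarith
    qed
  qed
  then have "e ! (w' - length r) = Invoke q (Write v)" "w' - length r < length e"
    using q by (auto simp: nth_append)
  then have "Invoke q (Write v) \<in> set e" by (metis nth_mem)
  then show ?thesis using v(1) by blast
qed

text \<open>Used to make a process idle before its next invocation. The added events contain no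
  invocation, so they bring in no new value.\<close>

lemma complete_pending:
  assumes "wait_free A" "run A r"
  shows "\<exists>s. run A (r @ s) \<and> \<not> pending (r @ s) (length (r @ s)) p \<and>
    (\<forall>x\<in>set s. actor x = p \<and> (\<forall>q y. x \<noteq> Invoke q y))"
proof (cases "pending r (length r) p")
  case True
  then obtain s y where s: "run A (r @ s @ [Return p y])"
    "\<forall>x\<in>set s. \<exists>o'. x = Get p o' \<or> x = Update p o'"
    using solo_completion[OF assms True] by blast
  have "\<not> pending ((r @ s) @ [Return p y]) (Suc (length (r @ s))) p"
    unfolding pending_snoc by simp
  then show ?thesis using s by (intro exI[of _ "s @ [Return p y]"]) auto
next
  case False
  then show ?thesis using assms(2) by (intro exI[of _ "[]"]) simp
qed

lemma solo_operation:
  assumes wf: "wait_free A" and run: "run A r" and en: "enabled A r (length r) (Invoke p x)"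
  shows "\<exists>s y. run A (r @ Invoke p x # s @ [Return p y]) \<and>
    (\<forall>x\<in>set s. \<exists>o'. x = Get p o' \<or> x = Update p o')"
proof -
  have "run A (r @ [Invoke p x])" using run en by (simp add: run_snoc)
  moreover have "pending (r @ [Invoke p x]) (length (r @ [Invoke p x])) p"
    by (simp add: pending_snoc)
  ultimately show ?thesis
    using solo_completion[OF wf, of "r @ [Invoke p x]" p] by simp
qed

lemma solo_write:
  assumes wf: "wait_free A" and run: "run A r" and en: "enabled A r (length r) (Invoke (writer A) (Write v))"
  shows "\<exists>e. run A (r @ e) \<and> \<not> pending (r @ e) (length (r @ e)) (writer A) \<and>
    write_completed (length r) (r @ e) \<and>
    (\<forall>x\<in>set e. actor x = writer A \<and> (\<forall>q y. x = Invoke q y \<longrightarrow> y = Write v))"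
proof -
  let ?w = "writer A"
  obtain s y where s: "run A (r @ Invoke ?w (Write v) # s @ [Return ?w y])"
    "\<forall>x\<in>set s. \<exists>o'. x = Get ?w o' \<or> x = Update ?w o'"
    using solo_operation[OF assms] by blast
  let ?e = "Invoke ?w (Write v) # s @ [Return ?w y]"
  have "\<not> pending ((r @ Invoke ?w (Write v) # s) @ [Return ?w y])
      (Suc (length (r @ Invoke ?w (Write v) # s))) ?w"
    unfolding pending_snoc by simp
  moreover have "write_completed (length r) (r @ ?e)"
    using returns_at_solo[of s ?w r "Write v" y] s(2)
    unfolding write_completed_def is_write_def
    by (intro exI[of _ "length r"] exI[of _ v] exI[of _ "length r + length s + 1"]) auto
  ultimately show ?thesis
    using s by (intro exI[of _ ?e]) auto
qed

lemma enabled_write: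
  assumes "initialized A r" "\<not> pending r (length r) (writer A)"
  shows "enabled A r (length r) (Invoke (writer A) (Write v))"
  using assms by (auto simp: enabled.simps is_reader_def initialized_def)

lemma enabled_read:
  assumes "initialized A r" "\<not> pending r (length r) p" "is_reader A p"
  shows "enabled A r (length r) (Invoke p Read)"
  using assms by (auto simp: enabled.simps is_reader_def initialized_def)

section \<open>Stopping one reader at a value that must stay stored\<close>

section \<open>Frozen readers\<close>

text \<open>The admissible continuations once the processes in \<open>F\<close> are stopped:
  guarantees extracted from stopped readers quantify over them.\<close>

definition avoids :: "'p set \<Rightarrow> 'v set \<Rightarrow> ('p, 'o, 'v) event list \<Rightarrow> bool" where
  "avoids F B e \<longleftrightarrow>
     (\<forall>x\<in>set e. actor x \<notin> F \<and> (\<forall>q v. x = Invoke q (Write v) \<longrightarrow> v \<notin> B))"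

lemma avoids_append: "avoids F B (e @ e') \<longleftrightarrow> avoids F B e \<and> avoids F B e'"
  by (auto simp: avoids_def)

lemma avoids_mono: "avoids F' B' e \<Longrightarrow> F \<subseteq> F' \<Longrightarrow> B \<subseteq> B' \<Longrightarrow> avoids F B e"
  unfolding avoids_def by blast

text \<open>The sizes of the process and value types are left to individual statements;
  \<open>reader_exists\<close> supplies a reader that can probe the storage.\<close>

locale disintegrated_register =
  fixes A :: "('p, 'o::finite, 'v, 'b, 'pm, 'om) algorithm" and \<tau> L :: nat
  assumes tau_pos: "0 < \<tau>"
    and emulation: "register_emulation A"
    and data_bounded: "local_data_bounded L A"
    and one_value: "blocks_pertain_to_one_value A"
    and regularity: "regular A"
    and wait_freedom: "wait_free A"
    and disintegration: "disintegrated \<tau> A"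
    and reader_exists: "\<exists>p. is_reader A p"
begin

text \<open>The read starts without labels, each access adds only stored labels, and the reader
  leaves the stored labels unchanged.\<close>

lemma held_labels_solo_read:
  assumes run: "run A (r @ Invoke p Read # s)"
    and s: "\<And>x. x \<in> set s \<Longrightarrow> \<exists>o'. x = Get p o' \<or> x = Update p o'"
    and "is_reader A p"
  shows "held_labels A p v (r @ Invoke p Read # s) \<subseteq> stored_labels A (r @ Invoke p Read # s) v"
  using run s
proof (induction s rule: rev_induct)
  case Nil
  then show ?case using held_labels_invoke_read[OF emulation, of r p v] by simp
next
  case (snoc x s)
  let ?r = "r @ Invoke p Read # s"
  have run: "run A ?r" using snoc.prems(1) run_appendD[of A ?r "[x]"] by simp
  obtain o' where x: "x = Get p o' \<or> x = Update p o'" using snoc.prems(2)[of x] by auto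
  have "held_labels A p v (?r @ [x]) \<subseteq> held_labels A p v ?r \<union> stored_labels A ?r v"
    using held_labels_access[OF run x, of v] by blast
  also have "\<dots> \<subseteq> stored_labels A ?r v" using snoc.IH[OF run] snoc.prems(2) by simp
  also have "\<dots> = stored_labels A (?r @ [x]) v"
    using stored_labels_readers[OF emulation, of ?r "[x]" v] snoc.prems(1) x \<open>is_reader A p\<close>
    by fastforce
  finally show ?case by simp
qed

text \<open>
  A reader that runs alone now has to return a recently written value, and as it does not change
  the stored blocks, all labels it collects are already in the shared storage.
\<close>

lemma enough_stored_labels:
  assumes run: "run A (r @ e)" and idle: "\<not> pending r (length r) (writer A)"
    and wc: "write_completed (length r) (r @ e)"
  shows "\<exists>v q. Invoke q (Write v) \<in> set e \<and> \<tau> \<le> card (stored_labels A (r @ e) v)"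
proof -
  \<comment> \<open>Any reader will do, even one stopped inside a read: the extension is
    hypothetical and first completes a pending operation.\<close>
  obtain p where p: "is_reader A p" using reader_exists by blast
  obtain s where s: "run A ((r @ e) @ s)" "\<not> pending ((r @ e) @ s) (length ((r @ e) @ s)) p"
    "\<forall>x\<in>set s. actor x = p \<and> (\<forall>q y. x \<noteq> Invoke q y)"
    using complete_pending[OF wait_freedom run, of p] by blast
  let ?r1 = "r @ e @ s"
  have run1: "run A ?r1" using s(1) by simp
  have "initialized A ?r1"
    using initialized_append[OF write_completed_initialized[OF run wc], of s] by simp
  then have "enabled A ?r1 (length ?r1) (Invoke p Read)"
    using enabled_read p s(2) by fastforce
  then obtain s' y where s': "run A (?r1 @ Invoke p Read # s' @ [Return p y])"
    "\<forall>x\<in>set s'. \<exists>o'. x = Get p o' \<or> x = Update p o'"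
    using solo_operation[OF wait_freedom run1] by blast
  let ?r2 = "?r1 @ Invoke p Read # s'" and ?e' = "e @ s @ Invoke p Read # s' @ [Return p y]"
  obtain w u j where w: "length r \<le> w" "is_write (r @ e) w u" "returns_at (r @ e) w j"
    using wc unfolding write_completed_def by blast
  have w': "is_write (r @ ?e') w u" "returns_at (r @ ?e') w j"
    using w(2) returns_at_append[OF w(3), of "s @ Invoke p Read # s' @ [Return p y]"]
    by (auto simp: is_write_def nth_append)
  have j: "j < length ?r1" using w(3) by (simp add: returns_at_def)
  have run': "run A (r @ ?e')" using s'(1) by simp
  have ret: "returns_at (r @ ?e') (length ?r1) (length ?r1 + length s' + 1)"
    using returns_at_solo[of s' p ?r1 Read y] s'(2) by simp
  have inv: "(r @ ?e') ! length ?r1 = Invoke p Read"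
    using nth_append_length[of ?r1 "Invoke p Read" "s' @ [Return p y]"] by simp
  have res: "(r @ ?e') ! (length ?r1 + length s' + 1) = Return p y"
    using nth_append_length[of ?r2 "Return p y" "[]"] by (simp add: add.assoc)
  obtain v q where v: "y = Some v" "Invoke q (Write v) \<in> set ?e'"
    using read_value_recent[OF regularity run' idle w(1) w' j inv ret res] by blast
  \<comment> \<open>The events added after \<open>e\<close> belong to a reader and invoke no
    write.\<close>
  then have "Invoke q (Write v) \<in> set e" using s(3) s'(2) by fastforce
  moreover have "\<tau> \<le> card (stored_labels A (r @ e) v)"
  proof -
    have run2: "run A (?r2 @ [Return p y])" using s'(1) by simp
    then have "enabled A ?r2 (length ?r2) (Return p (Some v))" and r2: "run A ?r2"
      unfolding run_snoc using v(1) by auto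
    then have "\<tau> \<le> card (held_labels A p v ?r2)"
      using disintegration p unfolding disintegrated_def by blast
    also have "\<dots> \<le> card (stored_labels A ?r2 v)"
      using held_labels_solo_read[of ?r1 p s' v] r2 s'(2) p finite_stored_labels
      by (intro card_mono) auto
    also have "stored_labels A ?r2 v = stored_labels A (r @ e) v"
    proof -
      have "is_reader A (actor x)" if "x \<in> set (s @ Invoke p Read # s')" for x
        using that s(3) s'(2) p by fastforce
      then show ?thesis
        using stored_labels_readers[OF emulation, of "r @ e" "s @ Invoke p Read # s'" v] r2 by simp
    qed
    finally show ?thesis .
  qed
  ultimately show ?thesis by blast
qed

definition held_values where
  "held_values p r = {v. held_labels A p v r \<noteq> {}}"

text \<open>Assign to each value a held block carrying one of its labels. A block has labels of one
  value only, so the assignment is injective, and the slots below \<open>L\<close> hold at most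
  \<open>L\<close> blocks.\<close>

lemma card_held_values:
  assumes run: "run A r" and p: "is_reader A p"
  shows "finite (held_values p r) \<and> card (held_values p r) \<le> L"
proof -
  let ?m = "pdata (pstate_at A r (length r) p)" and ?B = "local_blocks A r (length r) p"
  have dom: "dom ?m \<subseteq> {..<L}"
    using data_bounded run unfolding local_data_bounded_def by blast
  have "?B = (\<lambda>i. the (?m i)) ` dom ?m"
    unfolding local_blocks_def ran_def by (force simp: dom_def image_def)
  moreover have "finite (dom ?m)" "card (dom ?m) \<le> L"
    using dom finite_subset card_mono[OF _ dom] by auto
  ultimately have B: "finite ?B" "card ?B \<le> L"
    using card_image_le[of "dom ?m" "\<lambda>i. the (?m i)"] by auto
  have "\<exists>b\<in>?B. local_labels A r (length r) p b \<inter> (W r v \<times> UNIV) \<noteq> {}"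
    if "v \<in> held_values p r" for v
    using that unfolding held_values_def L_labels_def by blast
  then obtain f where f: "\<And>v. v \<in> held_values p r \<Longrightarrow>
      f v \<in> ?B \<and> local_labels A r (length r) p (f v) \<inter> (W r v \<times> UNIV) \<noteq> {}"
    by metis
  have "inj_on f (held_values p r)"
  proof (rule inj_onI)
    fix v v' assume vv: "v \<in> held_values p r" "v' \<in> held_values p r" "f v = f v'"
    obtain u where u: "local_labels A r (length r) p (f v) \<subseteq> W r u \<times> UNIV"
      using one_value run p f[OF vv(1)] unfolding blocks_pertain_to_one_value_def by blast
    have "v = u" using u f[OF vv(1)] W_disjoint[of _ r v u] by blast
    moreover have "v' = u" using u f[OF vv(2)] vv(3) W_disjoint[of _ r v' u] by auto
    ultimately show "v = v'" by simp
  qed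
  moreover have "f ` held_values p r \<subseteq> ?B" using f by blast
  ultimately show ?thesis
    using B by (meson card_inj_on_le finite_subset inj_on_finite le_trans)
qed

text \<open>
  If every newly obtained value could be erased from the shared storage down to fewer than \<open>\<tau>\<close>
  labels, counting those already held, then erasing it after each access of the reader would keep
  the reader from ever returning.
\<close>

lemma reader_freezes:
  assumes run: "run A (r @ e0)" and idle: "\<not> pending r (length r) (writer A)"
    and idle0: "\<not> pending (r @ e0) (length (r @ e0)) (writer A)"
    and p_idle: "\<not> pending (r @ e0) (length (r @ e0)) p"
    and wc: "write_completed (length r) (r @ e0)"
    and e0: "avoids F B e0" and p: "is_reader A p" "p \<notin> F"
    and F: "writer A \<notin> F"
  shows "\<exists>q e v. q = r @ e0 @ e \<and> run A q \<and> \<not> pending q (length q) (writer A) \<and> avoids F B e \<and>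
    v \<notin> B \<and> v \<in> held_values p q \<and>
    (\<forall>e'. run A (q @ e') \<and> avoids (insert p F) (B \<union> held_values p q) e' \<longrightarrow>
       \<tau> - 1 \<le> card (stored_labels A (q @ e') v))"
proof (rule ccontr)
  assume contra: "\<not> ?thesis"
  let ?I = "Invoke p Read"
  \<comment> \<open>The invariant of the schedule that never lets the read return: every held value
    outside \<open>B\<close> has fewer than \<open>\<tau>\<close> labels, counting held and stored
    ones together.\<close>
  define P where "P q \<longleftrightarrow> run A q \<and> \<not> pending q (length q) (writer A) \<and>
    pending q (length q) p \<and>
    (\<exists>e. q = r @ e0 @ ?I # e \<and> avoids F B e \<and> (\<forall>y. Return p y \<notin> set e)) \<and>
    (\<forall>v. v \<notin> B \<longrightarrow> v \<in> held_values p q \<longrightarrow>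
      card (held_labels A p v q \<union> stored_labels A q v) < \<tau>)" for q
  let ?q0 = "(r @ e0) @ [?I]"
  have "initialized A (r @ e0)" by (rule write_completed_initialized[OF run wc])
  then have run0: "run A ?q0"
    using run enabled_read[OF _ p_idle p(1)] unfolding run_snoc by blast
  have pw: "p \<noteq> writer A" using p(1) by (simp add: is_reader_def)
  show False
  proof (rule no_endless_operation[OF wait_freedom, of ?q0 p P])
    show pend: "pending ?q0 (length ?q0) p"
      using pending_snoc[of "r @ e0" ?I p] by simp
    have "\<not> pending ?q0 (length ?q0) (writer A)"
      using pending_snoc[of "r @ e0" ?I "writer A"] idle0 pw by auto
    moreover have "held_values p ?q0 = {}"
      using held_labels_invoke_read[OF emulation run0] unfolding held_values_def by blast
    ultimately show "P ?q0"
      using run0 pend unfolding P_def by (auto simp: avoids_def)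
    show "P q \<Longrightarrow> run A q" for q by (simp add: P_def)
  next
    fix q assume "P q"
    then obtain e where q: "run A q" "\<not> pending q (length q) (writer A)" "pending q (length q) p"
      and e: "q = r @ e0 @ ?I # e" "avoids F B e" "\<And>y. Return p y \<notin> set e"
      and small: "\<And>v. v \<notin> B \<Longrightarrow> v \<in> held_values p q \<Longrightarrow>
        card (held_labels A p v q \<union> stored_labels A q v) < \<tau>"
      unfolding P_def by blast
    \<comment> \<open>The returned value would be written in \<open>?e'\<close>, hence lie outside
      \<open>B\<close>; disintegration would then give \<open>\<tau>\<close> held labels of it,
      against \<open>small\<close>.\<close>
    have no_return: "next_action A p (pstate_at A q (length q) p) \<noteq> DoReturn y" for y
    proof
      assume ret: "next_action A p (pstate_at A q (length q) p) = DoReturn y"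
      then have en: "enabled A q (length q) (Return p y)" using q(3) by (simp add: enabled.simps)
      let ?e' = "e0 @ ?I # e @ [Return p y]"
      have run': "run A (r @ ?e')" using en q(1) run_snoc[of A q] e(1) by simp
      obtain w u j where w: "length r \<le> w" "is_write (r @ e0) w u" "returns_at (r @ e0) w j"
        using wc unfolding write_completed_def by blast
      have w': "is_write (r @ ?e') w u" "returns_at (r @ ?e') w j"
        using w(2) returns_at_append[OF w(3), of "?I # e @ [Return p y]"]
        by (auto simp: is_write_def nth_append)
      have j: "j < length (r @ e0)" using w(3) by (simp add: returns_at_def)
      have inv: "(r @ ?e') ! length (r @ e0) = ?I"
        using nth_append_length[of "r @ e0" ?I "e @ [Return p y]"] by simp
      have res: "(r @ ?e') ! length q = Return p y"
        using nth_append_length[of q "Return p y" "[]"] e(1) by simp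
      have ret': "returns_at (r @ ?e') (length (r @ e0)) (length q)"
      proof -
        have "(r @ ?e') ! k \<noteq> Return p y'" if "length (r @ e0) < k" "k < length q" for k y'
        proof -
          have "(r @ ?e') ! k = e ! (k - length (r @ e0) - 1)"
            using that e(1) by (auto simp: nth_append nth_Cons')
          moreover have "e ! (k - length (r @ e0) - 1) \<in> set e"
            using that e(1) by (intro nth_mem) auto
          ultimately show ?thesis using e(3) by metis
        qed
        then show ?thesis using inv res e(1) unfolding returns_at_def by auto
      qed
      obtain v q' where v: "y = Some v" "Invoke q' (Write v) \<in> set ?e'"
        using read_value_recent[OF regularity run' idle w(1) w' j inv ret' res] by blast
      then have "v \<notin> B" using e0 e(2) unfolding avoids_def by auto
      have "\<tau> \<le> card (held_labels A p v q)"
        using disintegration q(1) p(1) en v(1) unfolding disintegrated_def by blast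
      then have "v \<in> held_values p q" using tau_pos unfolding held_values_def by auto
      have "\<tau> \<le> card (held_labels A p v q \<union> stored_labels A q v)"
        using \<open>\<tau> \<le> _\<close> card_mono[of "held_labels A p v q \<union> stored_labels A q v" "held_labels A p v q"]
          finite_L_labels[of A p v q] finite_stored_labels[of A q v] by auto
      then show False using small[OF \<open>v \<notin> B\<close> \<open>v \<in> held_values p q\<close>] by simp
    qed
    obtain x ev where ev: "enabled A q (length q) ev" "ev = Get p x \<or> ev = Update p x"
    proof (cases "next_action A p (pstate_at A q (length q) p)")
      case (DoGet x)
      then show ?thesis using q(3) by (intro that[of "Get p x" x]) (auto simp: enabled.simps)
    next
      case (DoUpdate x)
      then show ?thesis using q(3) by (intro that[of "Update p x" x]) (auto simp: enabled.simps)
    qed (use no_return in auto)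
    let ?q1 = "q @ [ev]" and ?S = "shared_labels A q (length q) x"
    have run1: "run A ?q1" using ev(1) q(1) unfolding run_snoc by blast
    have idle1: "\<not> pending ?q1 (length ?q1) (writer A)"
      using pending_snoc[of q ev "writer A"] q(2) ev(2) by auto
    have pend1: "pending ?q1 (length ?q1) p"
      using pending_snoc[of q ev p] q(3) ev(2) by auto
    have e1: "?q1 = r @ e0 @ ?I # e @ [ev]" "avoids F B (e @ [ev])" "\<And>y. Return p y \<notin> set (e @ [ev])"
      using e ev(2) p(2) by (auto simp: avoids_def)
    have stored1: "stored_labels A ?q1 v = stored_labels A q v" for v
      using stored_labels_readers[OF emulation run1, of v] ev(2) p(1) by auto
    have held1: "held_labels A p v ?q1 \<subseteq> held_labels A p v q \<union> (stored_labels A q v \<inter> ?S)" for v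
      by (rule held_labels_access[OF q(1) ev(2)])
    \<comment> \<open>Every label gained by the access was already stored, so the union cannot
      grow.\<close>
    have old: "card (held_labels A p v ?q1 \<union> stored_labels A ?q1 v) < \<tau>"
      if "v \<notin> B" "v \<in> held_values p q" for v
    proof -
      have "card (held_labels A p v ?q1 \<union> stored_labels A ?q1 v) \<le>
          card (held_labels A p v q \<union> stored_labels A q v)"
        using held1[of v] stored1[of v] finite_L_labels[of A p v q] finite_stored_labels[of A q v]
        by (intro card_mono) auto
      then show ?thesis using small[OF that] by simp
    qed
    show "\<exists>e. P (q @ e) \<and> (\<exists>x\<in>set e. actor x = p) \<and> (\<forall>y. Return p y \<notin> set e)"
    proof (cases "\<forall>v. v \<notin> B \<longrightarrow> v \<in> held_values p ?q1 \<longrightarrow>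
        card (held_labels A p v ?q1 \<union> stored_labels A ?q1 v) < \<tau>")
      case True
      then have "P ?q1" using run1 idle1 pend1 e1 unfolding P_def by blast
      then show ?thesis using ev(2) by (intro exI[of _ "[ev]"]) auto
    next
      case False
      then obtain v where v: "v \<notin> B" "v \<in> held_values p ?q1" "v \<notin> held_values p q"
        using old by blast
      have new: "held_labels A p u ?q1 \<subseteq> ?S" if "u \<notin> held_values p q" for u
        using held1[of u] that unfolding held_values_def by blast
      have S: "finite ?S" "card ?S \<le> 1" using card_shared_labels[of A q] by auto
      \<comment> \<open>All labels of newly obtained values lie in \<open>?S\<close>, which has at
        most one element, and a label determines its value.\<close>
      have unique: "u = v" if u: "u \<in> held_values p ?q1" "u \<notin> held_values p q" for u
      proof -
        obtain l l' where l: "l \<in> held_labels A p u ?q1" "l' \<in> held_labels A p v ?q1"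
          using u(1) v(2) unfolding held_values_def by blast
        then have "l = l'" using new[OF u(2)] new[OF v(3)] S card_le_Suc0_iff_eq[OF S(1)] by auto
        then show ?thesis using l W_disjoint[of "fst l" ?q1 u v] unfolding L_labels_def by auto
      qed
      \<comment> \<open>By \<open>contra\<close>, stopping the reader at \<open>?q1\<close> does not
        retain \<open>v\<close>, so some schedule without \<open>p\<close> and without writes of
        held values erases \<open>v\<close> below \<open>\<tau> - 1\<close> stored labels.\<close>
      have "\<exists>e'. run A (?q1 @ e') \<and> avoids (insert p F) (B \<union> held_values p ?q1) e' \<and>
          card (stored_labels A (?q1 @ e') v) < \<tau> - 1"
      proof (rule ccontr)
        assume "\<not> ?thesis"
        then have "\<forall>e'. run A (?q1 @ e') \<and> avoids (insert p F) (B \<union> held_values p ?q1) e' \<longrightarrow>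
            \<tau> - 1 \<le> card (stored_labels A (?q1 @ e') v)"
          by (meson not_le)
        moreover have "avoids F B (?I # e @ [ev])"
          using e1(2) p(2) by (auto simp: avoids_def)
        ultimately show False using contra v run1 idle1 e1(1) by blast
      qed
      then obtain e' where e': "run A (?q1 @ e')" "avoids (insert p F) (B \<union> held_values p ?q1) e'"
        "card (stored_labels A (?q1 @ e') v) < \<tau> - 1"
        by blast
      \<comment> \<open>The erasing schedule may end inside a write, while \<open>P\<close> asks for
        an idle writer. Completing that write adds no label of a held value.\<close>
      obtain s where s: "run A ((?q1 @ e') @ s)"
        "\<not> pending ((?q1 @ e') @ s) (length ((?q1 @ e') @ s)) (writer A)"
        "\<forall>x\<in>set s. actor x = writer A \<and> (\<forall>q y. x \<noteq> Invoke q y)"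
        using complete_pending[OF wait_freedom e'(1), of "writer A"] by blast
      let ?q2 = "?q1 @ e' @ s"
      have av: "avoids (insert p F) (B \<union> held_values p ?q1) (e' @ s)"
        using e'(2) s(3) F pw unfolding avoids_append by (auto simp: avoids_def)
      have run2: "run A ?q2" using s(1) by simp
      have idle2: "\<not> pending ?q2 (length ?q2) (writer A)" using s(2) by simp
      have not_p: "actor z \<noteq> p" if "z \<in> set (e' @ s)" for z
        using av that unfolding avoids_def by blast
      have pend2: "pending ?q2 (length ?q2) p"
        using pending_other_process[of "e' @ s" p ?q1] not_p pend1 by blast
      have held2: "held_labels A p u ?q2 = held_labels A p u ?q1" for u
        using held_labels_other_process[of A ?q1 "e' @ s" p u] not_p run2 by blast
      have no_write: "Invoke z (Write u) \<notin> set (e' @ s)" if "u \<in> held_values p ?q1" for u z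
        using av that unfolding avoids_def by blast
      \<comment> \<open>For \<open>v\<close> at most one held and \<open>\<tau> - 2\<close> stored
        labels remain. The other held values are old and no write of them is invoked, so their
        counts have not grown.\<close>
      have "card (held_labels A p u ?q2 \<union> stored_labels A ?q2 u) < \<tau>"
        if u: "u \<notin> B" "u \<in> held_values p ?q2" for u
      proof -
        have u1: "u \<in> held_values p ?q1" using u(2) held2 unfolding held_values_def by simp
        show ?thesis
        proof (cases "u = v")
          case True
          have "stored_labels A ?q2 v \<subseteq> stored_labels A (?q1 @ e') v"
            by (rule stored_labels_antimono[OF emulation run2 idle1 no_write[OF v(2)]])
          then have "card (stored_labels A ?q2 v) < \<tau> - 1"
            using card_mono[OF finite_stored_labels] e'(3) by (meson le_less_trans)
          moreover have "card (held_labels A p v ?q2) \<le> 1"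
            using card_mono[OF S(1) new[OF v(3)]] S(2) held2[of v] by simp
          ultimately show ?thesis
            using card_Un_le[of "held_labels A p v ?q2" "stored_labels A ?q2 v"] True by simp
        next
          case False
          then have "u \<in> held_values p q" using unique[OF u1] by blast
          have "stored_labels A ?q2 u \<subseteq> stored_labels A ?q1 u"
            using stored_labels_antimono[OF emulation _ idle1, of "[]" "e' @ s" u]
              run2 no_write[OF u1] by simp
          then have "card (held_labels A p u ?q2 \<union> stored_labels A ?q2 u) \<le>
              card (held_labels A p u ?q1 \<union> stored_labels A ?q1 u)"
            using held2[of u] finite_L_labels[of A p u ?q1] finite_stored_labels[of A ?q1 u]
            by (intro card_mono) auto
          then show ?thesis using old[OF u(1) \<open>u \<in> held_values p q\<close>] by simp
        qed
      qed
      moreover have "\<exists>e. ?q2 = r @ e0 @ ?I # e \<and> avoids F B e \<and> (\<forall>y. Return p y \<notin> set e)"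
      proof (intro exI conjI)
        show "?q2 = r @ e0 @ ?I # (e @ [ev] @ e' @ s)" using e(1) by simp
        show "avoids F B (e @ [ev] @ e' @ s)"
          using e1(2) avoids_mono[OF av, of F B] unfolding avoids_append by blast
        show "\<forall>y. Return p y \<notin> set (e @ [ev] @ e' @ s)"
          using e1(3) not_p by fastforce
      qed
      ultimately have "P ?q2" using run2 idle2 pend2 unfolding P_def by blast
      then have "P (q @ [ev] @ e' @ s)" by simp
      moreover have "\<exists>z\<in>set ([ev] @ e' @ s). actor z = p" using ev(2) by auto
      moreover have "\<forall>y. Return p y \<notin> set ([ev] @ e' @ s)" using e1(3) not_p by fastforce
      ultimately show ?thesis by blast
    qed
  qed
qed

section \<open>Collecting retained values from several stopped readers\<close>

section \<open>Accumulating frozen readers\<close>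

text \<open>
  \<open>F\<close> consists of readers that are stopped in the middle of a read, and \<open>B\<close> of the values of which
  they hold labels. As each reader holds labels of at most \<open>L\<close> values, \<open>B\<close> leaves values to write.
\<close>

definition retains where
  "retains F B V r \<longleftrightarrow> run A r \<and> initialized A r \<and> \<not> pending r (length r) (writer A) \<and>
     writer A \<notin> F \<and> V \<subseteq> B \<and>
     (\<forall>e. run A (r @ e) \<and> avoids F B e \<longrightarrow> (\<forall>v\<in>V. \<tau> - 1 \<le> card (stored_labels A (r @ e) v)))"

lemma retains_initial: "\<exists>r. retains {} {} {} r"
proof -
  have "enabled A [] (length []) (Invoke (writer A) (Write (init_value A)))"
    by (simp add: enabled.simps is_reader_def pending_def)
  from solo_write[OF wait_freedom run_Nil this]
  obtain e where e: "run A e" "\<not> pending e (length e) (writer A)" "write_completed 0 e"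
    by auto
  then have "retains {} {} {} e"
    using write_completed_initialized[OF e(1,3)] unfolding retains_def by simp
  then show ?thesis by blast
qed

text \<open>A completed write of \<open>u\<close> separates the new read from all earlier writes, so
  the reader freezes at a value \<open>v\<close> outside \<open>B\<close>, which is new since
  \<open>V \<subseteq> B\<close>. Old guarantees persist because the whole construction avoids
  \<open>F\<close> and \<open>B\<close>.\<close>

lemma retains_extend:
  assumes ret: "retains F B V r" and u: "u \<notin> B" and p: "is_reader A p" "p \<notin> F"
  shows "\<exists>S v r'. finite S \<and> card S \<le> L \<and> v \<notin> B \<and> retains (insert p F) (B \<union> S) (insert v V) r'"
proof -
  have r: "run A r" "initialized A r" "\<not> pending r (length r) (writer A)" "writer A \<notin> F" "V \<subseteq> B"
    and keep: "\<And>e v. run A (r @ e) \<Longrightarrow> avoids F B e \<Longrightarrow> v \<in> V \<Longrightarrow> \<tau> - 1 \<le> card (stored_labels A (r @ e) v)"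
    using ret unfolding retains_def by blast+
  have pw: "p \<noteq> writer A" using p(1) by (simp add: is_reader_def)
  obtain e1 where e1: "run A (r @ e1)" "\<not> pending (r @ e1) (length (r @ e1)) (writer A)"
    "write_completed (length r) (r @ e1)"
    "\<forall>x\<in>set e1. actor x = writer A \<and> (\<forall>q y. x = Invoke q y \<longrightarrow> y = Write u)"
    using solo_write[OF wait_freedom r(1) enabled_write[OF r(2,3)], of u] by blast
  \<comment> \<open>An earlier read of \<open>p\<close> may still be pending and is completed
    first.\<close>
  obtain s where s: "run A ((r @ e1) @ s)" "\<not> pending ((r @ e1) @ s) (length ((r @ e1) @ s)) p"
    "\<forall>x\<in>set s. actor x = p \<and> (\<forall>q y. x \<noteq> Invoke q y)"
    using complete_pending[OF wait_freedom e1(1), of p] by blast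
  let ?e0 = "e1 @ s"
  have "run A (r @ ?e0)" using s(1) by simp
  moreover have "\<not> pending (r @ ?e0) (length (r @ ?e0)) (writer A)"
    using pending_other_process[of s "writer A" "r @ e1"] s(3) pw e1(2) by simp
  moreover have "\<not> pending (r @ ?e0) (length (r @ ?e0)) p" using s(2) by simp
  moreover have "write_completed (length r) (r @ ?e0)"
    using write_completed_append[OF e1(3), of s] by simp
  moreover have e0: "avoids F B ?e0"
    using e1(4) s(3) u p(2) r(4) unfolding avoids_def by fastforce
  ultimately obtain q e v where q: "q = r @ ?e0 @ e" "run A q" "\<not> pending q (length q) (writer A)"
    "avoids F B e" "v \<notin> B" "v \<in> held_values p q"
    and fr: "\<And>e'. run A (q @ e') \<Longrightarrow> avoids (insert p F) (B \<union> held_values p q) e' \<Longrightarrow>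
       \<tau> - 1 \<le> card (stored_labels A (q @ e') v)"
    using reader_freezes[OF _ r(3), of ?e0 p F B] p r(4) by blast
  have "retains (insert p F) (B \<union> held_values p q) (insert v V) q"
    unfolding retains_def
  proof (intro conjI allI impI ballI)
    show "initialized A q" using initialized_append[OF r(2)] q(1) by simp
    fix e' v' assume e': "run A (q @ e') \<and> avoids (insert p F) (B \<union> held_values p q) e'" "v' \<in> insert v V"
    show "\<tau> - 1 \<le> card (stored_labels A (q @ e') v')"
    proof (cases "v' = v")
      case False
      have "avoids F B (?e0 @ e @ e')"
        using e0 q(4) avoids_mono[of "insert p F" "B \<union> held_values p q" e' F B] e'(1)
        unfolding avoids_append by blast
      then show ?thesis using keep[of "?e0 @ e @ e'" v'] e' False q(1) by simp
    qed (use fr e' in blast)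
  qed (use q r pw in auto)
  then show ?thesis using card_held_values[OF q(2) p(1)] q(5) by blast
qed

text \<open>Stopping a further reader takes a value outside \<open>B\<close>. Only
  \<open>m - 1\<close> readers block values before the last one starts, at most \<open>L\<close>
  each; hence \<open>(m - 1) * L\<close> in the hypothesis against \<open>m * L\<close> in the
  conclusion.\<close>

lemma retains_many:
  assumes "m \<le> card {p. is_reader A p}" "(m - 1) * L < CARD('v)" "finite (UNIV :: 'p set)"
    and "finite (UNIV :: 'v set)"
  shows "\<exists>F B V r. retains F B V r \<and> F \<subseteq> {p. is_reader A p} \<and> card F = m \<and> card V = m \<and>
    card B \<le> m * L"
  using assms(1,2)
proof (induction m)
  case 0
  show ?case
    using retains_initial by (intro exI[of _ "{}"]) auto
next
  case (Suc m)
  have "(m - 1) * L \<le> m * L" by simp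
  also have "\<dots> < CARD('v)" using Suc.prems(2) by simp
  finally have "(m - 1) * L < CARD('v)" .
  then obtain F B V r where F: "retains F B V r" "F \<subseteq> {p. is_reader A p}" "card F = m"
    "card V = m" "card B \<le> m * L"
    using Suc.IH Suc.prems(1) by auto
  have "B \<noteq> UNIV" using F(5) Suc.prems(2) by auto
  then obtain u where u: "u \<notin> B" by blast
  have "F \<noteq> {p. is_reader A p}" using F(3) Suc.prems(1) by auto
  then obtain p where p: "is_reader A p" "p \<notin> F" using F(2) by blast
  obtain S v r' where S: "finite S" "card S \<le> L" "v \<notin> B"
    "retains (insert p F) (B \<union> S) (insert v V) r'"
    using retains_extend[OF F(1) u p] by blast
  have fin: "finite F" "finite V"
    using finite_subset[OF subset_UNIV] assms(3,4) by auto
  have "v \<notin> V" using S(3) F(1) unfolding retains_def by blast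
  moreover have "card (B \<union> S) \<le> Suc m * L"
    using card_Un_le[of B S] F(5) S(2) by simp
  ultimately show ?case
    using S(4) F p fin by (intro exI[of _ "insert p F"] exI[of _ "B \<union> S"] exI[of _ "insert v V"] exI[of _ r']) auto
qed

text \<open>
  While a value \<open>w\<close> replaces a value \<open>u\<close>, one of the two has at least \<open>\<tau>\<close> labels at every time.
  As each event removes at most one label, there is a time at which \<open>w\<close> already has \<open>\<tau>\<close> labels
  and \<open>u\<close> still has \<open>\<tau> - 1\<close>.
\<close>

lemma retains_bound:
  assumes ret: "retains F B V r" and uw: "u \<notin> B" "w \<notin> B" "u \<noteq> w" and V: "finite V"
  shows "\<tau> + (\<tau> - 1) * (card V + 1) \<le> CARD('o)"
proof -
  have r: "run A r" "initialized A r" "\<not> pending r (length r) (writer A)" "writer A \<notin> F" "V \<subseteq> B"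
    and keep: "\<And>e v. run A (r @ e) \<Longrightarrow> avoids F B e \<Longrightarrow> v \<in> V \<Longrightarrow> \<tau> - 1 \<le> card (stored_labels A (r @ e) v)"
    using ret unfolding retains_def by blast+
  obtain e1 where e1: "run A (r @ e1)" "\<not> pending (r @ e1) (length (r @ e1)) (writer A)"
    "write_completed (length r) (r @ e1)"
    "\<forall>x\<in>set e1. actor x = writer A \<and> (\<forall>q y. x = Invoke q y \<longrightarrow> y = Write u)"
    using solo_write[OF wait_freedom r(1) enabled_write[OF r(2,3)], of u] by blast
  have "initialized A (r @ e1)" by (rule initialized_append[OF r(2)])
  then obtain e2 where e2: "run A ((r @ e1) @ e2)" "write_completed (length (r @ e1)) ((r @ e1) @ e2)"
    "\<forall>x\<in>set e2. actor x = writer A \<and> (\<forall>q y. x = Invoke q y \<longrightarrow> y = Write w)"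
    using solo_write[OF wait_freedom e1(1) enabled_write[OF _ e1(2)], of w] by blast
  define q where "q n = r @ e1 @ take n e2" for n
  have run_q: "run A (q n)" for n
    using run_appendD[of A "q n" "drop n e2"] e2(1) by (simp add: q_def)
  have writes: "\<forall>x\<in>set (e1 @ take n e2). actor x = writer A \<and>
      (\<forall>z y. x = Invoke z y \<longrightarrow> y = Write u \<or> y = Write w)" for n
    using e1(4) e2(3) by (auto dest: in_set_takeD)
  \<comment> \<open>The write of \<open>w\<close> may be incomplete, but the completed write of
    \<open>u\<close> already rules out the values written only in \<open>r\<close>.\<close>
  have either: "\<tau> \<le> card (stored_labels A (q n) u) \<or> \<tau> \<le> card (stored_labels A (q n) w)" for n
  proof -
    have "write_completed (length r) (q n)"
      using write_completed_append[OF e1(3), of "take n e2"] by (simp add: q_def)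
    then obtain v z where "Invoke z (Write v) \<in> set (e1 @ take n e2)"
      "\<tau> \<le> card (stored_labels A (q n) v)"
      using enough_stored_labels[OF _ r(3), of "e1 @ take n e2"] run_q[of n] unfolding q_def by blast
    then show ?thesis using writes[of n] by fastforce
  qed
  have u0: "\<tau> \<le> card (stored_labels A (q 0) u)"
    using enough_stored_labels[OF e1(1) r(3) e1(3)] e1(4) by (fastforce simp: q_def)
  \<comment> \<open>With \<open>r @ e1\<close> as prefix, \<open>w\<close> is the only value written
    afterwards.\<close>
  have w_end: "\<tau> \<le> card (stored_labels A (q (length e2)) w)"
    using enough_stored_labels[OF e2(1) e1(2) e2(2)] e2(3) by (fastforce simp: q_def)
  have "\<exists>n. \<tau> - 1 \<le> card (stored_labels A (q n) u) \<and> \<tau> \<le> card (stored_labels A (q n) w)"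
  proof (cases "\<tau> \<le> card (stored_labels A (q (length e2)) u)")
    case True
    then show ?thesis using w_end by (intro exI[of _ "length e2"]) auto
  next
    case False
    \<comment> \<open>Here \<open>m\<close> is the time just before \<open>u\<close> first drops
      below \<open>\<tau>\<close>. One event costs at most one label, so \<open>\<tau> - 1\<close>
      remain, and \<open>either\<close> provides \<open>\<tau>\<close> labels of
      \<open>w\<close>.\<close>
    let ?P = "\<lambda>n. \<not> \<tau> \<le> card (stored_labels A (q n) u)"
    obtain m where m: "\<not> ?P m" "?P (Suc m)"
      using ex_least_nat_less[of ?P "length e2"] False u0 by auto
    then have "m < length e2" unfolding q_def by (metis linorder_not_less nat_le_linear take_all le_SucI)
    then have "q (Suc m) = q m @ [e2 ! m]" by (simp add: q_def take_Suc_conv_app_nth)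
    then have "\<tau> - 1 \<le> card (stored_labels A (q (Suc m)) u)"
      using card_stored_labels_snoc[OF run_q[of m], of u "e2 ! m"] m(1) by simp
    then show ?thesis using either[of "Suc m"] m(2) by blast
  qed
  then obtain n where n: "\<tau> - 1 \<le> card (stored_labels A (q n) u)" "\<tau> \<le> card (stored_labels A (q n) w)"
    by blast
  have "avoids F B (e1 @ take n e2)"
    using writes[of n] uw(1,2) r(4) unfolding avoids_def by fastforce
  then have v: "\<tau> - 1 \<le> card (stored_labels A (q n) v)" if "v \<in> V" for v
    using keep[of "e1 @ take n e2" v] run_q[of n] that unfolding q_def by blast
  have "\<tau> + (\<tau> - 1) * (card V + 1) = \<tau> + ((\<tau> - 1) + (\<Sum>v\<in>V. \<tau> - 1))"
    by (simp add: add_mult_distrib2 mult.commute)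
  also have "\<dots> \<le> card (stored_labels A (q n) w) +
      (card (stored_labels A (q n) u) + (\<Sum>v\<in>V. card (stored_labels A (q n) v)))"
    using n v by (intro add_mono sum_mono)
  \<comment> \<open>No value is counted twice, as \<open>u\<close> and \<open>w\<close> are distinct
    and lie outside \<open>B\<close>, which contains \<open>V\<close>.\<close>
  also have "\<dots> = (\<Sum>v\<in>insert w (insert u V). card (stored_labels A (q n) v))"
    using V uw r(5) by (subst sum.insert; auto)+
  also have "\<dots> \<le> CARD('o)" using V by (intro sum_card_stored_labels) auto
  finally show ?thesis .
qed

end

section \<open>The number of stopped readers and the final count\<close>

theorem theorem12:
  fixes A :: "('p, 'o::finite, 'v, 'b, 'pm, 'om) algorithm"
    and \<tau> L D R :: nat
  assumes "\<tau> > 1" and "L \<ge> 1"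
    and "CARD('v) = 2 ^ D" and "(2::nat) ^ D > 1"
    and "CARD('p) = R + 1" and "R > 1"
    and "register_emulation A"
    and "local_data_bounded L A"
    and "blocks_pertain_to_one_value A"
    and "regular A"
    and "wait_free A"
    and "disintegrated \<tau> A"
  shows "CARD('o) \<ge> \<tau> + (\<tau> - 1) * min (nat \<lceil>((2::real) ^ D - 1) / real L\<rceil>) R"
proof -
  \<comment> \<open>Both cardinalities are positive, so neither is the default 0 of an infinite
    type.\<close>
  have finp: "finite (UNIV :: 'p set)" and finv: "finite (UNIV :: 'v set)"
    using assms(3,5) by (auto intro: card_ge_0_finite)
  have "{p. is_reader A p} = UNIV - {writer A}" by (auto simp: is_reader_def)
  then have readers: "card {p. is_reader A p} = R"
    using assms(5) finp by (simp add: card_Diff_singleton)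
  then have "\<exists>p. is_reader A p" using \<open>R > 1\<close> by (metis Collect_empty_eq card.empty not_less_zero)
  then interpret disintegrated_register A \<tau> L
    using assms by unfold_locales auto
  define k where "k = min (nat \<lceil>((2::real) ^ D - 1) / real L\<rceil>) R"
  have D: "(1::real) < 2 ^ D" using assms(4) by (metis of_nat_1 of_nat_less_iff of_nat_numeral of_nat_power)
  \<comment> \<open>Positivity makes the conversion by \<open>nat\<close> exact and gives
    \<open>k \<ge> 1\<close>, so that \<open>k - 1\<close> is a true predecessor.\<close>
  have pos: "0 < \<lceil>((2::real) ^ D - 1) / real L\<rceil>" using D assms(2) by simp
  then have k: "0 < k" "k \<le> R" using \<open>R > 1\<close> by (auto simp: k_def)
  have "k \<le> nat \<lceil>((2::real) ^ D - 1) / real L\<rceil>" by (simp add: k_def)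
  \<comment> \<open>A ceiling exceeds its argument by less than 1, so
    \<open>(k - 1) * L < 2 ^ D - 1\<close>: two values remain even if \<open>k - 1\<close> readers
    block \<open>L\<close> values each.\<close>
  have kL: "(k - 1) * L + 2 \<le> 2 ^ D"
  proof -
    have "int k \<le> \<lceil>((2::real) ^ D - 1) / real L\<rceil>"
      using pos \<open>k \<le> nat _\<close> by linarith
    then have "real k - 1 < ((2::real) ^ D - 1) / real L" by linarith
    then have "real (k - 1) * real L < 2 ^ D - 1"
      using assms(2) k(1) by (simp add: field_simps of_nat_diff)
    then have "real ((k - 1) * L + 1) < real (2 ^ D)" by simp
    then have "(k - 1) * L + 1 < 2 ^ D" by (simp only: of_nat_less_iff)
    then show ?thesis by simp
  qed
  have "(k - 1 - 1) * L \<le> (k - 1) * L" by (rule mult_le_mono1) linarith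
  then have few: "(k - 1 - 1) * L < CARD('v)" using kL assms(3) by linarith
  have "k - 1 \<le> card {p. is_reader A p}" using readers k(2) by linarith
  \<comment> \<open>Only \<open>k - 1\<close> readers are stopped; the remaining share of
    \<open>\<tau> - 1\<close> labels comes from the value \<open>u\<close> that is being
    replaced.\<close>
  then obtain F B V r where F: "retains F B V r" "card V = k - 1" "card B \<le> (k - 1) * L"
    using retains_many[OF _ few finp finv] by blast
  have fin: "finite V" "finite B" using finite_subset[OF subset_UNIV finv] by auto
  have "card (- B) = CARD('v) - card B"
    using fin(2) by (simp add: Compl_eq_Diff_UNIV card_Diff_subset)
  then have "2 \<le> card (- B)" using kL F(3) assms(3) by linarith
  then obtain u w where "u \<in> - B" "w \<in> - B" "u \<noteq> w"
    by (metis card_2_iff' obtain_subset_with_card_n subsetD)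
  then have "\<tau> + (\<tau> - 1) * (card V + 1) \<le> CARD('o)"
    using retains_bound[OF F(1)] fin by auto
  then show ?thesis using F(2) k(1) unfolding k_def[symmetric] by simp
qed

end
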